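(* For any graph $G=(V,E)$ the minimum number $k$ of quasi-unicyclic subgraphs $H_1,\dots,H_k$ of $G$ with $E(H_1)\cup\cdots\cup E(H_k)=E$ is equal to $$\max_{\varnothing\ne U\subseteq V} \left\lceil \frac{e(G[U])}{|U|} \right\rceil,$$ where $e(G[U])$ denotes the number of edges induced by $U$ in $G$. Moreover, the minimum $k$ and a corresponding edge decomposition can be determined in polynomial time.
   Context: All graphs are finite and simple. A graph is quasi-unicyclic if each of its connected components is a tree or a unicyclic graph (a connected graph containing exactly one cycle). *)

theory Defs
  imports Complex_Main "HOL-Computational_Algebra.Polynomial"
begin

section \<open>Finite simple graphs\<close>

type_synonym 'a ugraph = "'a set \<times> 'a set set"

abbreviation verts :: "'a ugraph \<Rightarrow> 'a set" where "verts \<equiv> fst"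
abbreviation edges :: "'a ugraph \<Rightarrow> 'a set set" where "edges \<equiv> snd"

definition simple_graph :: "'a ugraph \<Rightarrow> bool" where
  "simple_graph G \<longleftrightarrow> finite (verts G) \<and>
     (\<forall>e\<in>edges G. \<exists>u\<in>verts G. \<exists>v\<in>verts G. u \<noteq> v \<and> e = {u, v})"

definition subgraph :: "'a ugraph \<Rightarrow> 'a ugraph \<Rightarrow> bool" where
  "subgraph H G \<longleftrightarrow> simple_graph H \<and> verts H \<subseteq> verts G \<and> edges H \<subseteq> edges G"

definition induced :: "'a ugraph \<Rightarrow> 'a set \<Rightarrow> 'a ugraph" where
  "induced G U = (U, {e \<in> edges G. e \<subseteq> U})"

definition adjacency :: "'a ugraph \<Rightarrow> ('a \<times> 'a) set" where
  "adjacency G = {(u, v). {u, v} \<in> edges G}"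

definition connected_graph :: "'a ugraph \<Rightarrow> bool" where
  "connected_graph G \<longleftrightarrow> verts G \<noteq> {} \<and>
     (\<forall>u\<in>verts G. \<forall>v\<in>verts G. (u, v) \<in> (adjacency G)\<^sup>*)"

definition graph_components :: "'a ugraph \<Rightarrow> 'a ugraph set" where
  "graph_components G = {induced G U | U. U \<subseteq> verts G \<and> connected_graph (induced G U) \<and>
     (\<forall>W. U \<subseteq> W \<and> W \<subseteq> verts G \<and> connected_graph (induced G W) \<longrightarrow> W = U)}"

definition closed_walk_edges :: "'a list \<Rightarrow> 'a set set" where
  "closed_walk_edges vs = {{vs ! i, vs ! (Suc i mod length vs)} | i. i < length vs}"

text \<open>
  A cycle is identified with its edge set, so that the rotations and the reversal of a
  vertex sequence count as one and the same cycle.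
\<close>

definition graph_cycles :: "'a ugraph \<Rightarrow> 'a set set set" where
  "graph_cycles G =
     {closed_walk_edges vs | vs. 3 \<le> length vs \<and> distinct vs \<and> closed_walk_edges vs \<subseteq> edges G}"

definition tree_graph :: "'a ugraph \<Rightarrow> bool" where
  "tree_graph G \<longleftrightarrow> connected_graph G \<and> graph_cycles G = {}"

definition unicyclic :: "'a ugraph \<Rightarrow> bool" where
  "unicyclic G \<longleftrightarrow> connected_graph G \<and> (\<exists>!C. C \<in> graph_cycles G)"

definition quasi_unicyclic :: "'a ugraph \<Rightarrow> bool" where
  "quasi_unicyclic G \<longleftrightarrow> (\<forall>K\<in>graph_components G. tree_graph K \<or> unicyclic K)"

definition quasi_unicyclic_cover :: "'a ugraph \<Rightarrow> nat \<Rightarrow> (nat \<Rightarrow> 'a ugraph) \<Rightarrow> bool" where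
  "quasi_unicyclic_cover G k H \<longleftrightarrow>
     (\<forall>i<k. subgraph (H i) G \<and> quasi_unicyclic (H i)) \<and> (\<Union>i<k. edges (H i)) = edges G"

definition min_cover_number :: "'a ugraph \<Rightarrow> nat \<Rightarrow> bool" where
  "min_cover_number G k \<longleftrightarrow> (\<exists>H. quasi_unicyclic_cover G k H) \<and>
     (\<forall>j. (\<exists>H. quasi_unicyclic_cover G j H) \<longrightarrow> k \<le> j)"


section \<open>Polynomial time\<close>

text \<open>
  Structured programs for a random access machine.  The memory consists of arrays, named by
  natural numbers (the names are fixed in the program text) and indexed by natural numbers
  (the indices are computed).  The only arithmetic operations are addition and truncated
  subtraction: in \<open>t\<close> steps the bit length of a stored number grows by at most
  \<open>O(t)\<close>, so the step count below is polynomially related to the running time on a Turing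
  machine.  With multiplication as a unit-cost operation this would fail.
\<close>

type_synonym memory = "nat \<Rightarrow> nat \<Rightarrow> nat"

datatype expr = Const nat | At nat expr | Plus expr expr | Minus expr expr

datatype prog =
    Store nat expr expr
  | Seq prog prog
  | Cond expr prog prog
  | While expr prog

fun val :: "memory \<Rightarrow> expr \<Rightarrow> nat" where
  "val M (Const c) = c"
| "val M (At a e) = M a (val M e)"
| "val M (Plus e f) = val M e + val M f"
| "val M (Minus e f) = val M e - val M f"

fun cost :: "expr \<Rightarrow> nat" where
  "cost (Const c) = 1"
| "cost (At a e) = Suc (cost e)"
| "cost (Plus e f) = Suc (cost e + cost f)"
| "cost (Minus e f) = Suc (cost e + cost f)"

text \<open>
  \<open>exec P M t M'\<close>: started in memory \<open>M\<close>, program \<open>P\<close> halts after \<open>t\<close> steps in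
  memory \<open>M'\<close>.  A condition holds if its value is nonzero.
\<close>

inductive exec :: "prog \<Rightarrow> memory \<Rightarrow> nat \<Rightarrow> memory \<Rightarrow> bool" where
  Store: "exec (Store a e f) M (Suc (cost e + cost f)) (M(a := (M a)(val M e := val M f)))"
| Seq: "exec P M s M' \<Longrightarrow> exec Q M' t M'' \<Longrightarrow> exec (Seq P Q) M (s + t) M''"
| Cond_True: "val M e \<noteq> 0 \<Longrightarrow> exec P M t M' \<Longrightarrow> exec (Cond e P Q) M (Suc (cost e + t)) M'"
| Cond_False: "val M e = 0 \<Longrightarrow> exec Q M t M' \<Longrightarrow> exec (Cond e P Q) M (Suc (cost e + t)) M'"
| While_True: "val M e \<noteq> 0 \<Longrightarrow> exec P M s M' \<Longrightarrow> exec (While e P) M' t M'' \<Longrightarrow>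
    exec (While e P) M (Suc (cost e + s + t)) M''"
| While_False: "val M e = 0 \<Longrightarrow> exec (While e P) M (Suc (cost e)) M"

inductive_cases exec_StoreE: "exec (Store a e f) M t M'"
inductive_cases exec_SeqE: "exec (Seq P Q) M t M'"
inductive_cases exec_CondE: "exec (Cond e P Q) M t M'"
inductive_cases exec_WhileE: "exec (While e P) M t M'"

lemma exec_deterministic:
  "exec P M t M' \<Longrightarrow> exec P M s M'' \<Longrightarrow> s = t \<and> M'' = M'"
proof (induction arbitrary: s M'' rule: exec.induct)
  case (Store a e f M)
  from Store.prems show ?case by (rule exec_StoreE) simp
next
  case (Seq P M t1 M1 Q t2 M2)
  from Seq.prems show ?case
    by (rule exec_SeqE) (metis Seq.IH)
next
  case (Cond_True M e P t M' Q)
  from Cond_True.prems show ?case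
    by (rule exec_CondE) ((metis Cond_True.IH), (use Cond_True.hyps(1) in simp))
next
  case (Cond_False M e Q t M' P)
  from Cond_False.prems show ?case
    by (rule exec_CondE) ((use Cond_False.hyps(1) in simp), (metis Cond_False.IH))
next
  case (While_True M e P t1 M1 t2 M2)
  from While_True.prems show ?case
    by (rule exec_WhileE) (metis While_True.IH, use While_True.hyps(1) in simp)
next
  case (While_False M e P)
  from While_False.prems show ?case
    by (rule exec_WhileE) (use While_False.hyps in simp_all)
qed

text \<open>
  A search problem is given by its set of instances, their representation in the initial memory,
  their size, and the relation between an instance and the final memories holding a correct answer.
\<close>

definition polynomial_time ::
  "'i set \<Rightarrow> ('i \<Rightarrow> memory) \<Rightarrow> ('i \<Rightarrow> nat) \<Rightarrow> ('i \<Rightarrow> memory \<Rightarrow> bool) \<Rightarrow> bool" where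
  "polynomial_time I enc sz correct \<longleftrightarrow>
     (\<exists>(P :: prog) (p :: nat poly). \<forall>x\<in>I. \<exists>t M.
        exec P (enc x) t M \<and> t \<le> poly p (sz x) \<and> correct x M)"


section \<open>Representation of graphs and decompositions in memory\<close>

text \<open>
  An instance \<open>(n, es)\<close> represents the graph with vertices \<open>0, \<dots>, n - 1\<close> whose edges are
  listed in \<open>es\<close> without repetition, in any order and with either order of the two ends.
\<close>

type_synonym edge_list = "nat \<times> (nat \<times> nat) list"

definition edge_at :: "edge_list \<Rightarrow> nat \<Rightarrow> nat set" where
  "edge_at x i = {fst (snd x ! i), snd (snd x ! i)}"

definition edge_lists :: "edge_list set" where
  "edge_lists = {x. (\<forall>(u, v)\<in>set (snd x). u < fst x \<and> v < fst x \<and> u \<noteq> v) \<and>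
     inj_on (edge_at x) {..<length (snd x)}}"

definition graph_of :: "edge_list \<Rightarrow> nat ugraph" where
  "graph_of x = ({..<fst x}, edge_at x ` {..<length (snd x)})"

definition graph_size :: "edge_list \<Rightarrow> nat" where
  "graph_size x = fst x + length (snd x)"

text \<open>
  Input: array 0 holds the numbers of vertices and of edges, arrays 1 and 2 hold the ends of the
  edges; all other cells are 0.
\<close>

definition input_memory :: "edge_list \<Rightarrow> memory" where
  "input_memory x = (\<lambda>a i.
     if a = 0 \<and> i = 0 then fst x
     else if a = 0 \<and> i = 1 then length (snd x)
     else if a = 1 \<and> i < length (snd x) then fst (snd x ! i)
     else if a = 2 \<and> i < length (snd x) then snd (snd x ! i)
     else 0)"

text \<open>
  Output: cell 0 of array 3 holds the number of parts, and cell \<open>i\<close> of array 4 holds the index of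
  the part containing the edge at position \<open>i\<close>; the parts are therefore edge-disjoint.
\<close>

definition output_number :: "memory \<Rightarrow> nat" where
  "output_number M = M 3 0"

definition output_part :: "edge_list \<Rightarrow> memory \<Rightarrow> nat \<Rightarrow> nat ugraph" where
  "output_part x M j = ({..<fst x}, edge_at x ` {i. i < length (snd x) \<and> M 4 i = j})"

definition optimal_output :: "edge_list \<Rightarrow> memory \<Rightarrow> bool" where
  "optimal_output x M \<longleftrightarrow> min_cover_number (graph_of x) (output_number M) \<and>
     quasi_unicyclic_cover (graph_of x) (output_number M) (output_part x M)"

end

theory Submission
  imports Defs
begin

text \<open>
  A graph is quasi-unicyclic iff its edges can be assigned injectively to one of their ends: a connected
  graph with two different cycles has more edges than vertices, and an acyclic graph has fewer.  Hence
  \<open>k\<close> parts suffice iff the edges can be matched into the slots \<open>V \<times> {0, \<dots>, k - 1}\<close>, each edge into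
  a slot of one of its ends, and Hall's condition becomes \<open>e(G[U]) \<le> k |U|\<close> for all \<open>U\<close>.

  Both Hall's theorem and the algorithm rest on one labelling procedure, which needs no search for
  augmenting paths.  Every slot has a label, initially 0.  An item is put into one of its options of
  least label, that label is raised by one, and the item that was there, if any, is the next to be placed.
  If all options of an item have labels above the number of slots, then some label value is not attained,
  and the items placed above it violate Hall's condition.  The sum of the labels bounds the number of
  steps.  The algorithm runs this procedure with \<open>k = 0, 1, 2, \<dots>\<close> until all edges are placed.
\<close>

section \<open>Cycles and edge numbers\<close>

text \<open>Two positions carrying the same edge are equal or each is the cyclic successor of the
  other; the latter is impossible for length at least 3.\<close>

lemma inj_on_cycle_edges:
  assumes "distinct vs" "3 \<le> length vs"
  shows "inj_on (\<lambda>i. {vs ! i, vs ! (Suc i mod length vs)}) {..<length vs}"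
proof (rule inj_onI)
  let ?n = "length vs"
  fix i j assume ij: "i \<in> {..<?n}" "j \<in> {..<?n}"
    and eq: "{vs ! i, vs ! (Suc i mod ?n)} = {vs ! j, vs ! (Suc j mod ?n)}"
  have lt: "Suc i mod ?n < ?n" "Suc j mod ?n < ?n" using assms(2) by (auto intro!: mod_less_divisor)
  from eq have "i = j \<or> (i = Suc j mod ?n \<and> Suc i mod ?n = j)"
    using ij lt assms(1) by (auto simp: doubleton_eq_iff nth_eq_iff_index_eq)
  then show "i = j"
    using ij assms(2) by (auto simp: mod_Suc split: if_splits)
qed

lemma sym_adjacency: "sym (adjacency G)"
  by (auto simp: sym_def adjacency_def insert_commute)

lemma adjacency_mono: "E \<subseteq> F \<Longrightarrow> adjacency (V, E) \<subseteq> adjacency (W, F)"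
  by (auto simp: adjacency_def)

text \<open>Go round the cycle the other way: from the far end of the edge at position
  \<open>i\<close>, the later positions modulo \<open>?n\<close> are reached one by one until
  \<open>i\<close> itself. Injectivity of the edge enumeration keeps the removed edge off this
  walk.\<close>

lemma cycle_bypass:
  assumes "distinct vs" "3 \<le> length vs" "{a, b} \<in> closed_walk_edges vs"
  shows "(a, b) \<in> (adjacency (V, closed_walk_edges vs - {{a, b}}))\<^sup>*"
proof -
  let ?n = "length vs" and ?e = "\<lambda>i. {vs ! i, vs ! (Suc i mod length vs)}"
  obtain i where i: "i < ?n" "{a, b} = ?e i"
    using assms(3) by (auto simp: closed_walk_edges_def)
  let ?R = "adjacency (V, closed_walk_edges vs - {{a, b}})"
  have reach: "(vs ! (Suc i mod ?n), vs ! ((i + Suc j) mod ?n)) \<in> ?R\<^sup>*" if "j < ?n" for j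
    using that
  proof (induction j)
    case 0 then show ?case by simp
  next
    case (Suc j)
    let ?l = "(i + Suc j) mod ?n"
    have l: "?l < ?n" using Suc.prems by (auto intro: mod_less_divisor)
    have "?l \<noteq> i"
      using i(1) Suc.prems by (cases "i + Suc j < ?n") (simp_all add: le_mod_geq)
    then have "?e ?l \<noteq> ?e i"
      using inj_on_cycle_edges[OF assms(1,2)] l i(1) \<open>?l \<noteq> i\<close>
      by (metis (mono_tags, lifting) inj_onD lessThan_iff)
    then have "?e ?l \<in> closed_walk_edges vs - {{a, b}}"
      using l unfolding i(2) closed_walk_edges_def by blast
    moreover have "Suc ?l mod ?n = (i + Suc (Suc j)) mod ?n"
      by (simp add: mod_Suc_eq)
    ultimately have "(vs ! ?l, vs ! ((i + Suc (Suc j)) mod ?n)) \<in> ?R"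
      by (auto simp: adjacency_def)
    with Suc.IH Suc.prems show ?case by (simp add: rtrancl_into_rtrancl)
  qed
  have "(vs ! (Suc i mod ?n), vs ! i) \<in> ?R\<^sup>*"
  proof -
    have "i + Suc (?n - 1) = i + ?n" using i(1) by simp
    then have "(i + Suc (?n - 1)) mod ?n = i" using i(1) by simp
    then show ?thesis using reach[of "?n - 1"] i(1) by simp
  qed
  moreover from this have "(vs ! i, vs ! (Suc i mod ?n)) \<in> ?R\<^sup>*"
    using sym_rtrancl[OF sym_adjacency] by (meson symD)
  ultimately show ?thesis
    using i(2) unfolding doubleton_eq_iff by metis
qed

text \<open>The rest of the cycle still joins the ends of the lost edge.\<close>

lemma connected_remove_cycle_edge:
  assumes "connected_graph (V, E)" "C \<in> graph_cycles (V, E)" "e \<in> C"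
  shows "connected_graph (V, E - {e})"
proof -
  obtain vs where vs: "C = closed_walk_edges vs" "3 \<le> length vs" "distinct vs" "C \<subseteq> E"
    using assms(2) by (auto simp: graph_cycles_def)
  have "adjacency (V, E) \<subseteq> (adjacency (V, E - {e}))\<^sup>*"
  proof clarify
    fix a b assume ab: "(a, b) \<in> adjacency (V, E)"
    show "(a, b) \<in> (adjacency (V, E - {e}))\<^sup>*"
    proof (cases "{a, b} = e")
      case True
      have "adjacency (V, C - {{a, b}}) \<subseteq> adjacency (V, E - {e})"
        using vs(4) True by (intro adjacency_mono) auto
      then show ?thesis
        using cycle_bypass[OF vs(3,2)] True assms(3) vs(1) rtrancl_mono by blast
    next
      case False
      then show ?thesis using ab by (auto simp: adjacency_def)
    qed
  qed
  then have "(adjacency (V, E))\<^sup>* \<subseteq> (adjacency (V, E - {e}))\<^sup>*"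
    by (rule rtrancl_subset_rtrancl)
  then show ?thesis using assms(1) by (auto simp: connected_graph_def)
qed

section \<open>Edge numbers of connected graphs\<close>

lemma simple_graph_finite_edges: "simple_graph G \<Longrightarrow> finite (edges G)"
  by (rule finite_subset[of _ "Pow (verts G)"]) (auto simp: simple_graph_def)

lemma simple_graph_edge_subset: "simple_graph G \<Longrightarrow> e \<in> edges G \<Longrightarrow> e \<subseteq> verts G"
  by (auto simp: simple_graph_def)

text \<open>Fix a root \<open>r\<close> with distance function \<open>d\<close>. Every other vertex
  \<open>v\<close> picks an edge to some \<open>p v\<close> nearer to \<open>r\<close>. The choice
  is injective: two vertices picking the same edge would each be nearer than the other.\<close>

lemma connected_card_le:
  assumes "simple_graph (V, E)" "connected_graph (V, E)"
  shows "card V \<le> card E + 1"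
proof -
  let ?R = "adjacency (V, E)"
  obtain r where r: "r \<in> V" using assms(2) by (auto simp: connected_graph_def)
  define d where "d v = (LEAST n. (r, v) \<in> ?R ^^ n)" for v
  have "\<exists>u. {v, u} \<in> E \<and> d u < d v" if v: "v \<in> V - {r}" for v
  proof -
    have "(r, v) \<in> ?R\<^sup>*" using assms(2) r v by (auto simp: connected_graph_def)
    then obtain n where "(r, v) \<in> ?R ^^ n" by (auto simp: rtrancl_power)
    then have dv: "(r, v) \<in> ?R ^^ d v" unfolding d_def by (rule LeastI)
    then obtain k where k: "d v = Suc k" using v by (cases "d v") auto
    with dv obtain u where u: "(r, u) \<in> ?R ^^ k" "(u, v) \<in> ?R" by auto
    have "d u \<le> k" unfolding d_def using u(1) by (rule Least_le)
    with u k show ?thesis by (auto simp: adjacency_def insert_commute)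
  qed
  then obtain p where p: "\<And>v. v \<in> V - {r} \<Longrightarrow> {v, p v} \<in> E \<and> d (p v) < d v" by metis
  have "inj_on (\<lambda>v. {v, p v}) (V - {r})"
  proof (rule inj_onI)
    fix v w assume vw: "v \<in> V - {r}" "w \<in> V - {r}" and "{v, p v} = {w, p w}"
    then have "v = w \<or> (v = p w \<and> w = p v)" by (auto simp: doubleton_eq_iff)
    moreover have "\<not> (v = p w \<and> w = p v)" using p[OF vw(1)] p[OF vw(2)] by (metis less_asym)
    ultimately show "v = w" by blast
  qed
  then have "card (V - {r}) \<le> card E"
    by (rule card_inj_on_le) (use p simple_graph_finite_edges[OF assms(1)] in auto)
  then show ?thesis using r by (simp add: card_Diff_singleton)
qed

lemma simple_graph_subset: "simple_graph (V, E) \<Longrightarrow> F \<subseteq> E \<Longrightarrow> simple_graph (V, F)"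
  by (auto simp: simple_graph_def)

lemma cycle_nonempty: "C \<in> graph_cycles G \<Longrightarrow> C \<noteq> {}"
  unfolding graph_cycles_def closed_walk_edges_def by force

lemma cycle_subset: "C \<in> graph_cycles G \<Longrightarrow> C \<subseteq> edges G"
  by (auto simp: graph_cycles_def)

text \<open>An edge of \<open>C\<close> outside \<open>D\<close> can be removed without breaking
  connectedness. The cycle \<open>D\<close> survives, so one of its edges can be removed as well,
  and the remaining connected graph still has at least \<open>card V - 1\<close> edges.\<close>

lemma two_cycles_card:
  assumes "simple_graph (V, E)" "connected_graph (V, E)"
    and C: "C \<in> graph_cycles (V, E)" and D: "D \<in> graph_cycles (V, E)" and "\<not> C \<subseteq> D"
  shows "card V < card E"
proof -
  obtain e where e: "e \<in> C" "e \<notin> D" using assms(5) by auto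
  obtain e' where e': "e' \<in> D" using cycle_nonempty[OF D] by auto
  have D': "D \<in> graph_cycles (V, E - {e})"
    using D e(2) by (auto simp: graph_cycles_def)
  have "connected_graph (V, E - {e} - {e'})"
    by (rule connected_remove_cycle_edge[OF connected_remove_cycle_edge[OF assms(2) C e(1)] D' e'])
  moreover have "simple_graph (V, E - {e} - {e'})"
    by (rule simple_graph_subset[OF assms(1)]) auto
  ultimately have "card V \<le> card (E - {e} - {e'}) + 1"
    by (intro connected_card_le)
  moreover have "e \<in> E" "e' \<in> E" "e \<noteq> e'" using e e' cycle_subset[OF C] cycle_subset[OF D] by auto
  moreover have "finite E" using simple_graph_finite_edges[OF assms(1)] by simp
  ultimately show ?thesis
    using card_Suc_Diff1[of E e] card_Suc_Diff1[of "E - {e}" e'] by simp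
qed

lemma simple_graph_induced:
  assumes "simple_graph G" "U \<subseteq> verts G"
  shows "simple_graph (induced G U)"
proof -
  have "finite U" using assms by (auto simp: simple_graph_def intro: finite_subset)
  then show ?thesis using assms(1) by (fastforce simp: simple_graph_def induced_def)
qed

text \<open>Inside a component, \<open>f\<close> maps edges injectively to vertices of that
  component. So no component has more edges than vertices, which by \<open>two_cycles_card\<close>
  makes any two of its cycles equal.\<close>

lemma inj_owner_imp_quasi_unicyclic:
  assumes "simple_graph G" "inj_on f (edges G)" "\<And>e. e \<in> edges G \<Longrightarrow> f e \<in> e"
  shows "quasi_unicyclic G"
  unfolding quasi_unicyclic_def
proof
  fix K assume "K \<in> graph_components G"
  then obtain U where K: "K = induced G U" "U \<subseteq> verts G" "connected_graph K"
    by (auto simp: graph_components_def)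
  obtain E where KE: "K = (U, E)" "E = {e \<in> edges G. e \<subseteq> U}" using K(1) by (auto simp: induced_def)
  have simple: "simple_graph (U, E)" using simple_graph_induced[OF assms(1) K(2)] K(1) KE(1) by simp
  have finU: "finite U" using simple by (simp add: simple_graph_def)
  have "card E \<le> card U"
    using assms(2,3) KE(2) finU by (intro card_inj_on_le[of f]) (auto intro: inj_on_subset)
  then have "C \<subseteq> D" if "C \<in> graph_cycles K" "D \<in> graph_cycles K" for C D
    using two_cycles_card[OF simple, of C D] that K(3) KE(1) by fastforce
  then have "C = D" if "C \<in> graph_cycles K" "D \<in> graph_cycles K" for C D
    using that by (meson subset_antisym)
  then show "tree_graph K \<or> unicyclic K"
    using K(3) by (auto simp: tree_graph_def unicyclic_def)
qed

section \<open>Sparsity of acyclic and quasi-unicyclic graphs\<close>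

text \<open>Take a longest path. Its first vertex has a neighbour other than the second vertex of
  the path; by maximality this neighbour lies on the path and closes a cycle.\<close>

lemma min_degree_two_cycle:
  assumes "simple_graph (V, E)" "V \<noteq> {}"
    and deg: "\<And>v. v \<in> V \<Longrightarrow> \<exists>e\<in>E. \<exists>f\<in>E. e \<noteq> f \<and> v \<in> e \<and> v \<in> f"
  shows "graph_cycles (V, E) \<noteq> {}"
proof -
  define P where "P vs \<longleftrightarrow> vs \<noteq> [] \<and> distinct vs \<and> set vs \<subseteq> V \<and>
    (\<forall>i. Suc i < length vs \<longrightarrow> {vs ! i, vs ! Suc i} \<in> E)" for vs
  have finV: "finite V" using assms(1) by (simp add: simple_graph_def)
  obtain v where "v \<in> V" using assms(2) by auto
  then have "P [v]" by (auto simp: P_def)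
  moreover have "length vs < Suc (card V)" if "P vs" for vs
    using that card_mono[OF finV, of "set vs"] distinct_card[of vs] by (auto simp: P_def)
  ultimately obtain vs where vs: "P vs" and longest: "\<And>ws. P ws \<Longrightarrow> length ws \<le> length vs"
    using ex_has_greatest_nat[of P "[v]" length "Suc (card V)"] by (metis less_imp_le)
  let ?v = "vs ! 0"
  have v: "?v \<in> V" using vs by (auto simp: P_def)
  \<comment> \<open>For a path with a single vertex, \<open>vs ! 1\<close> is an unspecified value.
    The choice of \<open>w\<close> works all the same: of two different edges at \<open>?v\<close>,
    at most one has this value as its other end.\<close>
  obtain w where w: "{?v, w} \<in> E" "w \<noteq> vs ! 1" "w \<in> V" "w \<noteq> ?v"
  proof -
    obtain e f where ef: "e \<in> E" "f \<in> E" "e \<noteq> f" "?v \<in> e" "?v \<in> f" using deg[OF v] by auto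
    have other: "\<exists>u. g = {?v, u} \<and> u \<in> V \<and> u \<noteq> ?v" if g: "g \<in> E" "?v \<in> g" for g
    proof -
      obtain a b where "a \<in> V" "b \<in> V" "a \<noteq> b" "g = {a, b}"
        using assms(1) g(1) unfolding simple_graph_def by fastforce
      then show ?thesis using g(2) by (cases "?v = a") auto
    qed
    obtain u1 where u1: "e = {?v, u1}" "u1 \<in> V" "u1 \<noteq> ?v" using other[OF ef(1,4)] by auto
    obtain u2 where u2: "f = {?v, u2}" "u2 \<in> V" "u2 \<noteq> ?v" using other[OF ef(2,5)] by auto
    show ?thesis
    proof (cases "u1 = vs ! 1")
      case True
      then show ?thesis using that[of u2] u1 u2 ef(2,3) by auto
    next
      case False
      then show ?thesis using that[of u1] u1 ef(1) by auto
    qed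
  qed
  have "w \<in> set vs"
  proof (rule ccontr)
    assume "w \<notin> set vs"
    moreover have "{(w # vs) ! i, (w # vs) ! Suc i} \<in> E" if "Suc i < length (w # vs)" for i
      using that vs w(1) by (cases i) (simp_all add: P_def insert_commute)
    ultimately have "P (w # vs)"
      using vs w(3) by (simp add: P_def)
    then show False using longest by fastforce
  qed
  then obtain j where j: "j < length vs" "vs ! j = w" by (auto simp: in_set_conv_nth)
  have j2: "2 \<le> j"
  proof (rule ccontr)
    assume "\<not> 2 \<le> j"
    then have "j = 0 \<or> j = 1" by auto
    then show False using w j by auto
  qed
  let ?c = "take (Suc j) vs"
  have len: "length ?c = Suc j" using j by simp
  have "closed_walk_edges ?c \<subseteq> E"
  proof
    fix e assume "e \<in> closed_walk_edges ?c"
    then obtain i where i: "i < Suc j" "e = {?c ! i, ?c ! (Suc i mod Suc j)}"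
      unfolding closed_walk_edges_def len by auto
    show "e \<in> E"
    proof (cases "i = j")
      case True
      then show ?thesis using i j w by (simp add: insert_commute)
    next
      case False
      then show ?thesis using i j vs by (simp add: P_def)
    qed
  qed
  then have "closed_walk_edges ?c \<in> graph_cycles (V, E)"
    using len j2 vs by (auto simp: graph_cycles_def P_def intro!: exI[of _ ?c])
  then show ?thesis by auto
qed

text \<open>By \<open>min_degree_two_cycle\<close> some vertex lies on at most one edge; deleting it
  costs one vertex and at most one edge, and creates no cycle.\<close>

lemma acyclic_card_less:
  assumes "simple_graph (V, E)" "V \<noteq> {}" "graph_cycles (V, E) = {}"
  shows "card E < card V"
  using assms
proof (induction "card V" arbitrary: V E rule: less_induct)
  case less
  have fin: "finite V" using less.prems(1) by (simp add: simple_graph_def)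
  have finE: "finite E" using simple_graph_finite_edges[OF less.prems(1)] by simp
  obtain v where v: "v \<in> V" "\<And>e f. e \<in> E \<Longrightarrow> f \<in> E \<Longrightarrow> v \<in> e \<Longrightarrow> v \<in> f \<Longrightarrow> e = f"
    using min_degree_two_cycle[OF less.prems(1,2)] less.prems(3) by metis
  let ?V = "V - {v}" and ?E = "{e \<in> E. v \<notin> e}"
  have "card {e \<in> E. v \<in> e} \<le> 1"
    using finE v(2) by (auto simp: card_le_Suc0_iff_eq)
  moreover have "card E = card ?E + card {e \<in> E. v \<in> e}"
    using finE by (subst card_Un_disjoint[symmetric]) (auto intro: arg_cong[where f = card])
  moreover have cV: "card V = Suc (card ?V)" using card_Suc_Diff1[OF fin v(1)] by simp
  moreover have "card ?E < card ?V" if "?V \<noteq> {}"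
  proof (rule less.hyps[OF _ _ that])
    show "card ?V < card V" using cV by simp
    show "simple_graph (?V, ?E)" using less.prems(1) by (fastforce simp: simple_graph_def)
    show "graph_cycles (?V, ?E) = {}" using less.prems(3) by (auto simp: graph_cycles_def)
  qed
  moreover have "E = {}" if "?V = {}"
  proof -
    have "V = {v}" using that v(1) by auto
    then show ?thesis using less.prems(1) by (auto simp: simple_graph_def)
  qed
  ultimately show ?case by (cases "?V = {}") auto
qed

text \<open>The edges inside \<open>W\<close> contain at most one cycle. Without one edge of that
  cycle they are acyclic, hence fewer than \<open>card W\<close>.\<close>

lemma component_sparse:
  assumes "simple_graph (V, E)" "tree_graph (V, E) \<or> unicyclic (V, E)" "W \<subseteq> V"
  shows "card {e \<in> E. e \<subseteq> W} \<le> card W"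
proof (cases "W = {}")
  case True
  then have "{e \<in> E. e \<subseteq> W} = {}" using assms(1) by (auto simp: simple_graph_def)
  then show ?thesis by (metis card.empty le0)
next
  case False
  let ?F = "{e \<in> E. e \<subseteq> W}"
  have sW: "simple_graph (W, ?F)"
    using simple_graph_induced[OF assms(1)] assms(3) by (simp add: induced_def)
  \<comment> \<open>\<open>graph_cycles\<close> looks only at the edge set, so \<open>V\<close> may
    be replaced by \<open>W\<close>.\<close>
  have acyc: "card F < card W" if "F \<subseteq> ?F" "graph_cycles (V, F) = {}" for F
    using acyclic_card_less[OF simple_graph_subset[OF sW that(1)] False] that(2)
    by (simp add: graph_cycles_def)
  show ?thesis
  proof (cases "graph_cycles (V, ?F) = {}")
    case True then show ?thesis using acyc[of ?F] by simp
  next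
    case False
    then obtain C where C: "C \<in> graph_cycles (V, ?F)" by auto
    obtain e where e: "e \<in> C" using cycle_nonempty[OF C] by auto
    have sub: "graph_cycles (V, ?F) \<subseteq> graph_cycles (V, E)" by (auto simp: graph_cycles_def)
    have uniq: "D = C" if "D \<in> graph_cycles (V, ?F)" for D
      using assms(2) C that sub by (auto simp: tree_graph_def unicyclic_def)
    have "graph_cycles (V, ?F - {e}) = {}"
    proof (rule ccontr)
      assume "graph_cycles (V, ?F - {e}) \<noteq> {}"
      then obtain D where D: "D \<in> graph_cycles (V, ?F - {e})" by auto
      then have "D \<in> graph_cycles (V, ?F)" by (auto simp: graph_cycles_def)
      then show False using uniq e cycle_subset[OF D] by auto
    qed
    then have "card (?F - {e}) < card W" by (intro acyc) auto
    moreover have "e \<in> ?F" using e cycle_subset[OF C] by auto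
    moreover have "finite ?F" using simple_graph_finite_edges[OF sW] by simp
    ultimately show ?thesis using card_Suc_Diff1[of ?F e] by linarith
  qed
qed

text \<open>Components are defined as maximal connected induced subgraphs; this identifies them with
  reachability classes.\<close>

lemma reachable_component:
  assumes "simple_graph G" "v \<in> verts G"
  shows "induced G ((adjacency G)\<^sup>* `` {v}) \<in> graph_components G"
proof -
  let ?A = "adjacency G" and ?U = "(adjacency G)\<^sup>* `` {v}"
  have mem: "b \<in> verts G" if "(a, b) \<in> ?A" for a b
    using that simple_graph_edge_subset[OF assms(1)] by (auto simp: adjacency_def)
  have UV: "?U \<subseteq> verts G"
  proof
    fix w assume "w \<in> ?U"
    then have "(v, w) \<in> ?A\<^sup>*" by simp
    then show "w \<in> verts G" by (induction rule: rtrancl_induct) (use assms(2) mem in auto)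
  qed
  \<comment> \<open>A walk from \<open>v\<close> never leaves the reachable set, so it is also a
    walk in the induced graph.\<close>
  have ind: "(v, w) \<in> (adjacency (induced G ?U))\<^sup>*" if "(v, w) \<in> ?A\<^sup>*" for w
    using that
  proof (induction rule: rtrancl_induct)
    case (step y z)
    have "(v, z) \<in> ?A\<^sup>*" using step.hyps by (rule rtrancl_into_rtrancl)
    then have "(y, z) \<in> adjacency (induced G ?U)"
      using step.hyps by (auto simp: adjacency_def induced_def)
    with step.IH show ?case by (rule rtrancl_into_rtrancl)
  qed simp
  have "connected_graph (induced G ?U)"
    unfolding connected_graph_def
  proof (intro conjI ballI)
    show "verts (induced G ?U) \<noteq> {}" by (auto simp: induced_def)
    fix a b assume "a \<in> verts (induced G ?U)" "b \<in> verts (induced G ?U)"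
    then have "(v, a) \<in> (adjacency (induced G ?U))\<^sup>*" "(v, b) \<in> (adjacency (induced G ?U))\<^sup>*"
      using ind by (auto simp: induced_def)
    then show "(a, b) \<in> (adjacency (induced G ?U))\<^sup>*"
      using sym_rtrancl[OF sym_adjacency] by (meson rtrancl_trans symD)
  qed
  moreover have "W = ?U" if "?U \<subseteq> W" "connected_graph (induced G W)" for W
  proof -
    have "(adjacency (induced G W))\<^sup>* \<subseteq> ?A\<^sup>*"
      by (rule rtrancl_mono) (auto simp: adjacency_def induced_def)
    moreover have "v \<in> W" using that(1) by auto
    ultimately have "W \<subseteq> ?U" using that(2) by (auto simp: connected_graph_def induced_def)
    with that(1) show ?thesis by auto
  qed
  ultimately show ?thesis using UV by (auto simp: graph_components_def)
qed

text \<open>Split \<open>U\<close> along the component of one of its vertices. No edge crosses the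
  split; \<open>component_sparse\<close> bounds the edges inside the component and induction the
  others.\<close>

lemma quasi_unicyclic_sparse:
  assumes G: "simple_graph G" "quasi_unicyclic G" and "U \<subseteq> verts G"
  shows "card {e \<in> edges G. e \<subseteq> U} \<le> card U"
  using assms(3)
proof (induction "card U" arbitrary: U rule: less_induct)
  case less
  have finU: "finite U" using less.prems G(1) by (auto simp: simple_graph_def intro: finite_subset)
  have finE: "finite (edges G)" by (rule simple_graph_finite_edges[OF G(1)])
  show ?case
  proof (cases "U = {}")
    case True
    then have "{e \<in> edges G. e \<subseteq> U} = {}" using G(1) by (auto simp: simple_graph_def)
    then show ?thesis by (metis card.empty le0)
  next
    case False
    then obtain v where v: "v \<in> U" by auto
    let ?R = "(adjacency G)\<^sup>* `` {v}"
    have comp: "induced G ?R \<in> graph_components G"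
      using reachable_component[OF G(1)] v less.prems by auto
    then have RV: "?R \<subseteq> verts G" by (auto simp: graph_components_def induced_def)
    have split: "{e \<in> edges G. e \<subseteq> U} \<subseteq>
        {e \<in> edges G. e \<subseteq> U \<inter> ?R} \<union> {e \<in> edges G. e \<subseteq> U - ?R}"
    proof
      fix e assume e: "e \<in> {e \<in> edges G. e \<subseteq> U}"
      then obtain a b where ab: "e = {a, b}" using G(1) by (auto simp: simple_graph_def)
      then have "(a, b) \<in> adjacency G" "(b, a) \<in> adjacency G"
        using e by (auto simp: adjacency_def insert_commute)
      then have "a \<in> ?R \<longleftrightarrow> b \<in> ?R" by (auto intro: rtrancl_into_rtrancl)
      then show "e \<in> {e \<in> edges G. e \<subseteq> U \<inter> ?R} \<union> {e \<in> edges G. e \<subseteq> U - ?R}" using e ab by auto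
    qed
    have "tree_graph (induced G ?R) \<or> unicyclic (induced G ?R)"
      using comp G(2) by (auto simp: quasi_unicyclic_def)
    then have "card {e \<in> {e \<in> edges G. e \<subseteq> ?R}. e \<subseteq> U \<inter> ?R} \<le> card (U \<inter> ?R)"
      using simple_graph_induced[OF G(1) RV] by (intro component_sparse) (auto simp: induced_def)
    also have "{e \<in> {e \<in> edges G. e \<subseteq> ?R}. e \<subseteq> U \<inter> ?R} = {e \<in> edges G. e \<subseteq> U \<inter> ?R}" by auto
    finally have "card {e \<in> edges G. e \<subseteq> U \<inter> ?R} \<le> card (U \<inter> ?R)" .
    moreover have "card {e \<in> edges G. e \<subseteq> U - ?R} \<le> card (U - ?R)"
      using v less.prems finU by (intro less.hyps psubset_card_mono) auto
    moreover have "card U = card (U \<inter> ?R) + card (U - ?R)"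
      using finU by (subst card_Un_disjoint[symmetric]) (auto intro: arg_cong[where f = card])
    moreover have "card {e \<in> edges G. e \<subseteq> U} \<le>
        card {e \<in> edges G. e \<subseteq> U \<inter> ?R} + card {e \<in> edges G. e \<subseteq> U - ?R}"
      by (rule order_trans[OF card_mono[OF _ split] card_Un_le]) (use finE in auto)
    ultimately show ?thesis by linarith
  qed
qed

section \<open>Hall's theorem by labelling\<close>

text \<open>\<open>D\<close> is the set of items placed so far. Occupancy is not recorded
  separately: a slot holds an item iff its label is positive, and at label 0 the value of
  \<open>H\<close> carries no meaning.\<close>

definition placement :: "'s set \<Rightarrow> ('e \<Rightarrow> 's set) \<Rightarrow> 'e set \<Rightarrow> ('s \<Rightarrow> nat) \<Rightarrow> ('s \<Rightarrow> 'e) \<Rightarrow> bool" where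
  "placement S A D L H \<longleftrightarrow>
     inj_on H {s \<in> S. 0 < L s} \<and> H ` {s \<in> S. 0 < L s} = D \<and>
     (\<forall>s\<in>S. 0 < L s \<longrightarrow> s \<in> A (H s) \<and> (\<forall>t\<in>A (H s). L s \<le> Suc (L t)))"

text \<open>One move of the procedure. For \<open>c\<close> the bound on label drops holds because
  \<open>b\<close> has least label among its options; for other items it holds because their own
  labels stay and those of their options do not decrease.\<close>

lemma placement_swap:
  assumes P: "placement S A D L H" and "c \<notin> D" "b \<in> S" "b \<in> A c" and min: "\<And>t. t \<in> A c \<Longrightarrow> L b \<le> L t"
  shows "placement S A (insert c D - (if L b = 0 then {} else {H b})) (L(b := Suc (L b))) (H(b := c))"
proof -
  let ?O = "{s \<in> S. 0 < L s}" and ?L = "L(b := Suc (L b))" and ?H = "H(b := c)"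
  have O: "{s \<in> S. 0 < ?L s} = insert b ?O" using assms(3) by auto
  have inj: "inj_on H ?O" and im: "H ` ?O = D"
    and opt: "\<And>s. s \<in> S \<Longrightarrow> 0 < L s \<Longrightarrow> s \<in> A (H s) \<and> (\<forall>t\<in>A (H s). L s \<le> Suc (L t))"
    using P by (auto simp: placement_def)
  have im': "H ` (?O - {b}) = D - (if L b = 0 then {} else {H b})"
    using im inj assms(3) by (auto simp: inj_on_def)
  have "inj_on ?H (insert b ?O)"
    using inj im assms(2) by (auto simp: inj_on_def)
  moreover have "?H ` insert b ?O = insert c (H ` (?O - {b}))" by auto
  moreover have "\<dots> = insert c D - (if L b = 0 then {} else {H b})"
    using im' im assms(2,3) by auto
  moreover have "s \<in> A (?H s) \<and> (\<forall>t\<in>A (?H s). ?L s \<le> Suc (?L t))" if "s \<in> S" "0 < ?L s" for s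
    using that opt[of s] assms(4) min
    by (cases "s = b") (fastforce intro: le_SucI)+
  ultimately show ?thesis unfolding placement_def O by auto
qed

text \<open>
  Some label value \<open>j \<le> card S\<close> is not attained.  Labels drop by at most one from a slot to the other
  options of its item, so the items held above \<open>j\<close> have all their options above \<open>j\<close>.
\<close>
lemma placement_stuck:
  assumes P: "placement S A D L H" and "finite S" "c \<notin> D" and A: "\<And>e. A e \<subseteq> S"
    and stuck: "\<And>t. t \<in> A c \<Longrightarrow> card S < L t"
  obtains J where "J \<subseteq> insert c D" "J \<noteq> {}" "finite J" "card (\<Union>e\<in>J. A e) < card J"
proof -
  have "card (L ` S) < card {..card S}" using card_image_le[OF assms(2), of L] by simp
  then have "\<not> {..card S} \<subseteq> L ` S"
    by (meson assms(2) card_mono finite_imageI linorder_not_le)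
  then obtain j where j: "j \<le> card S" "j \<notin> L ` S" by auto
  define T where "T = {s \<in> S. j < L s}"
  have "finite T" using assms(2) by (simp add: T_def)
  have T: "T \<subseteq> {s \<in> S. 0 < L s}" by (auto simp: T_def)
  have inj: "inj_on H T" using P T by (auto simp: placement_def intro: inj_on_subset)
  have HT: "H ` T \<subseteq> D" using P T by (auto simp: placement_def)
  have "A (H s) \<subseteq> T" if "s \<in> T" for s
  proof
    fix t assume t: "t \<in> A (H s)"
    then have "t \<in> S" using A by auto
    moreover from this have "L t \<noteq> j" using j(2) by auto
    moreover have "L s \<le> Suc (L t)" using P that t by (auto simp: placement_def T_def)
    ultimately show "t \<in> T" using that by (auto simp: T_def)
  qed
  moreover have "A c \<subseteq> T" using stuck A j(1) by (fastforce simp: T_def)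
  ultimately have "(\<Union>e\<in>insert c (H ` T). A e) \<subseteq> T" by blast
  then have "card (\<Union>e\<in>insert c (H ` T). A e) \<le> card T" using \<open>finite T\<close> by (rule card_mono[rotated])
  also have "\<dots> < card (insert c (H ` T))"
    using assms(3) HT \<open>finite T\<close> by (subst card_insert_disjoint) (auto simp: card_image[OF inj])
  finally show thesis using that[of "insert c (H ` T)"] HT \<open>finite T\<close> by auto
qed

text \<open>If \<open>b\<close> was occupied, the displaced item takes over the role of
  \<open>c\<close> and \<open>insert c D\<close> stays the same set. Hall's condition rules out
  getting stuck, so only labels up to \<open>card S\<close> are raised and the sum of the gaps to
  \<open>Suc (card S)\<close> decreases.\<close>

lemma placement_insert:
  assumes "finite S" and A: "\<And>e. A e \<subseteq> S"
    and hall: "\<And>J. J \<subseteq> I \<Longrightarrow> finite J \<Longrightarrow> card J \<le> card (\<Union>e\<in>J. A e)"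
    and "placement S A D L H" "insert c D \<subseteq> I" "c \<notin> D" "\<And>s. s \<in> S \<Longrightarrow> L s \<le> Suc (card S)"
  shows "\<exists>L H. placement S A (insert c D) L H \<and> (\<forall>s\<in>S. L s \<le> Suc (card S))"
  using assms(4-)
proof (induction "\<Sum>s\<in>S. Suc (card S) - L s" arbitrary: D L H c rule: less_induct)
  case less
  have "\<exists>t\<in>A c. L t \<le> card S"
  proof (rule ccontr)
    assume "\<not> ?thesis"
    then obtain J where "J \<subseteq> insert c D" "finite J" "card (\<Union>e\<in>J. A e) < card J"
      using placement_stuck[OF less.prems(1) assms(1) less.prems(3) A] by (metis not_le)
    then show False using hall[of J] less.prems(2) by auto
  qed
  then obtain b where b: "b \<in> A c" "\<And>t. t \<in> A c \<Longrightarrow> L b \<le> L t" "L b \<le> card S"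
    using ex_has_least_nat[of "\<lambda>t. t \<in> A c" _ L] by (metis le_trans)
  have bS: "b \<in> S" using b(1) A by auto
  let ?L = "L(b := Suc (L b))" and ?H = "H(b := c)"
  note swap = placement_swap[OF less.prems(1,3) bS b(1,2)]
  have bound: "\<And>s. s \<in> S \<Longrightarrow> ?L s \<le> Suc (card S)" using less.prems(4) b(3) by auto
  show ?case
  proof (cases "L b = 0")
    case True
    then show ?thesis using swap bound by auto
  next
    case False
    let ?D = "insert c D - {H b}"
    have Hb: "H b \<in> D" using less.prems(1) False bS by (auto simp: placement_def)
    have "(\<Sum>s\<in>S. Suc (card S) - ?L s) < (\<Sum>s\<in>S. Suc (card S) - L s)"
      using b(3) bS assms(1) by (intro sum_strict_mono_ex1) auto
    moreover have "insert (H b) ?D = insert c D" using Hb by auto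
    ultimately show ?thesis
      using less.hyps[of ?L ?D ?H "H b"] swap False less.prems(2) bound by auto
  qed
qed

text \<open>Items are placed one after another; the inverse of \<open>H\<close> on the occupied
  slots is the matching.\<close>

theorem hall:
  assumes "finite S" "finite I" and A: "\<And>e. A e \<subseteq> S"
    and hall: "\<And>J. J \<subseteq> I \<Longrightarrow> finite J \<Longrightarrow> card J \<le> card (\<Union>e\<in>J. A e)"
  obtains f where "inj_on f I" "\<And>e. e \<in> I \<Longrightarrow> f e \<in> A e"
proof -
  have "\<exists>L H. placement S A D L H \<and> (\<forall>s\<in>S. L s \<le> Suc (card S))" if "finite D" "D \<subseteq> I" for D
    using that
  proof (induction D rule: finite_induct)
    case empty
    show ?case by (rule exI[of _ "\<lambda>_. 0"]) (auto simp: placement_def)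
  next
    case (insert c D)
    then obtain L H where "placement S A D L H" "\<forall>s\<in>S. L s \<le> Suc (card S)" by auto
    then show ?case
      using placement_insert[OF assms(1) A hall] insert.prems insert.hyps(2) by blast
  qed
  then obtain L H where P: "placement S A I L H" using assms(2) by blast
  let ?O = "{s \<in> S. 0 < L s}"
  have bij: "bij_betw H ?O I" using P by (auto simp: placement_def bij_betw_def)
  show thesis
  proof (rule that[of "inv_into ?O H"])
    show "inj_on (inv_into ?O H) I" using bij by (metis bij_betw_def bij_betw_inv_into)
    fix e assume e: "e \<in> I"
    then have "inv_into ?O H e \<in> ?O" "H (inv_into ?O H e) = e"
      using bij by (auto simp: bij_betw_def inv_into_into f_inv_into_f)
    then show "inv_into ?O H e \<in> A e" using P by (auto simp: placement_def)
  qed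
qed

section \<open>Covers and density\<close>

text \<open>Each part contributes at most \<open>card U\<close> edges inside
  \<open>U\<close>.\<close>

lemma cover_sparse:
  assumes "simple_graph G" "quasi_unicyclic_cover G k H" "U \<subseteq> verts G"
  shows "card {e \<in> edges G. e \<subseteq> U} \<le> k * card U"
proof -
  let ?F = "\<lambda>i. {e \<in> edges (H i). e \<subseteq> U}"
  have H: "subgraph (H i) G" "quasi_unicyclic (H i)" if "i < k" for i
    using assms(2) that by (auto simp: quasi_unicyclic_cover_def)
  have finU: "finite U" using assms(1,3) by (auto simp: simple_graph_def intro: finite_subset)
  have "card (?F i) \<le> card U" if "i < k" for i
  proof -
    have simple: "simple_graph (H i)" using H(1)[OF that] by (simp add: subgraph_def)
    \<comment> \<open>\<open>U\<close> may contain vertices outside \<open>H i\<close>, so sparsity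
      is applied to the intersection.\<close>
    have "?F i = {e \<in> edges (H i). e \<subseteq> U \<inter> verts (H i)}"
      using simple_graph_edge_subset[OF simple] by auto
    also have "card \<dots> \<le> card (U \<inter> verts (H i))"
      by (rule quasi_unicyclic_sparse[OF simple H(2)[OF that]]) auto
    also have "\<dots> \<le> card U" using finU by (rule card_mono) auto
    finally show ?thesis .
  qed
  then have "(\<Sum>i<k. card (?F i)) \<le> k * card U"
    using sum_bounded_above[of "{..<k}" "\<lambda>i. card (?F i)" "card U"] by simp
  moreover have "{e \<in> edges G. e \<subseteq> U} = (\<Union>i<k. ?F i)"
    using assms(2) by (auto simp: quasi_unicyclic_cover_def)
  moreover have "card (\<Union>i<k. ?F i) \<le> (\<Sum>i<k. card (?F i))" by (rule card_UN_le) simp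
  ultimately show ?thesis by simp
qed

text \<open>The pair \<open>(own e, col e)\<close> is the slot of \<open>e\<close>. On one colour
  class \<open>own\<close> alone is injective, so the class is quasi-unicyclic.\<close>

lemma coloured_owner_cover:
  assumes "simple_graph G" "inj_on (\<lambda>e. (own e, col e)) (edges G)"
    and own: "\<And>e. e \<in> edges G \<Longrightarrow> own e \<in> e" and col: "\<And>e. e \<in> edges G \<Longrightarrow> col e < k"
  shows "quasi_unicyclic_cover G k (\<lambda>j. (verts G, {e \<in> edges G. col e = j}))"
  unfolding quasi_unicyclic_cover_def
proof (intro conjI allI impI)
  fix j
  have simple: "simple_graph (verts G, {e \<in> edges G. col e = j})"
    using assms(1) by (auto simp: simple_graph_def)
  then show "subgraph (verts G, {e \<in> edges G. col e = j}) G" by (auto simp: subgraph_def)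
  show "quasi_unicyclic (verts G, {e \<in> edges G. col e = j})"
    by (rule inj_owner_imp_quasi_unicyclic[OF simple, of own])
      (use assms(2) own in \<open>auto simp: inj_on_def\<close>)
next
  show "(\<Union>j<k. edges (verts G, {e \<in> edges G. col e = j})) = edges G" using col by auto
qed

text \<open>For sufficiency, the edges of a set \<open>J\<close> have together
  \<open>k * card (\<Union>J)\<close> slots, and \<open>J\<close> is contained in the edges induced
  by \<open>\<Union>J\<close>; so the density bound is Hall's condition.\<close>

lemma cover_iff_sparse:
  assumes "simple_graph G"
  shows "(\<exists>H. quasi_unicyclic_cover G k H) \<longleftrightarrow>
    (\<forall>U\<subseteq>verts G. card {e \<in> edges G. e \<subseteq> U} \<le> k * card U)"
proof
  assume "\<exists>H. quasi_unicyclic_cover G k H"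
  then show "\<forall>U\<subseteq>verts G. card {e \<in> edges G. e \<subseteq> U} \<le> k * card U"
    using cover_sparse[OF assms] by blast
next
  assume sparse: "\<forall>U\<subseteq>verts G. card {e \<in> edges G. e \<subseteq> U} \<le> k * card U"
  \<comment> \<open>Intersecting with \<open>verts G\<close> makes
    \<open>?A e \<subseteq> ?S\<close> true for every set \<open>e\<close>, as \<open>hall\<close>
    demands.\<close>
  let ?S = "verts G \<times> {..<k}" and ?A = "\<lambda>e. (e \<inter> verts G) \<times> {..<k}"
  have finV: "finite (verts G)" using assms by (simp add: simple_graph_def)
  have finE: "finite (edges G)" by (rule simple_graph_finite_edges[OF assms])
  have "card J \<le> card (\<Union>e\<in>J. ?A e)" if J: "J \<subseteq> edges G" for J
  proof -
    have sub: "\<Union>J \<subseteq> verts G" using J simple_graph_edge_subset[OF assms] by blast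
    have "card J \<le> card {e \<in> edges G. e \<subseteq> \<Union>J}" using finE J by (intro card_mono) auto
    also have "\<dots> \<le> k * card (\<Union>J)" using sparse sub by blast
    also have "\<dots> = card (\<Union>J \<times> {..<k})" by (simp add: card_cartesian_product)
    also have "\<Union>J \<times> {..<k} = (\<Union>e\<in>J. ?A e)" using sub by blast
    finally show ?thesis .
  qed
  note marriage = this
  obtain f where f: "inj_on f (edges G)" "\<And>e. e \<in> edges G \<Longrightarrow> f e \<in> ?A e"
  proof (rule hall[of ?S "edges G" ?A])
    show "finite ?S" "finite (edges G)" using finV finE by simp_all
    show "?A e \<subseteq> ?S" for e by auto
  qed (use marriage in auto)
  have "quasi_unicyclic_cover G k (\<lambda>j. (verts G, {e \<in> edges G. snd (f e) = j}))"
    by (rule coloured_owner_cover[OF assms, of "fst \<circ> f"]) (use f in \<open>fastforce simp: inj_on_def\<close>)+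
  then show "\<exists>H. quasi_unicyclic_cover G k H" by (rule exI[of _ "\<lambda>j. (verts G, {e \<in> edges G. snd (f e) = j})"])
qed

lemma min_cover_number_eq_Max:
  fixes G :: "'a ugraph"
  assumes "simple_graph G" "verts G \<noteq> {}"
  shows "\<exists>k. min_cover_number G k \<and>
     int k = Max {\<lceil>real (card (edges (induced G U))) / real (card U)\<rceil> | U. U \<noteq> {} \<and> U \<subseteq> verts G}"
proof -
  let ?r = "\<lambda>U. \<lceil>real (card (edges (induced G U))) / real (card U)\<rceil>"
  let ?\<U> = "{U. U \<noteq> {} \<and> U \<subseteq> verts G}"
  have finV: "finite (verts G)" using assms(1) by (simp add: simple_graph_def)
  have fin: "finite (?r ` ?\<U>)" using finV by simp
  have ne: "?r ` ?\<U> \<noteq> {}" using assms(2) by auto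
  have density: "card {e \<in> edges G. e \<subseteq> U} \<le> j * card U \<longleftrightarrow> ?r U \<le> int j" if "U \<in> ?\<U>" for U j
  proof -
    have "0 < card U" using that finV by (auto simp: card_gt_0_iff intro: finite_subset)
    then have "?r U \<le> int j \<longleftrightarrow> real (card (edges (induced G U))) \<le> real j * real (card U)"
      by (simp add: ceiling_le_iff pos_divide_le_eq)
    then show ?thesis by (simp add: induced_def flip: of_nat_mult)
  qed
  \<comment> \<open>The empty set is among the sets in \<open>cover_iff_sparse\<close> but not in
    the maximum; it induces no edge.\<close>
  have "{e \<in> edges G. e \<subseteq> {}} = {}" using assms(1) by (auto simp: simple_graph_def)
  then have empty_sparse: "card {e \<in> edges G. e \<subseteq> {}} \<le> j * card ({} :: 'a set)" for j
    by (metis card.empty le0)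
  have cover: "(\<exists>H. quasi_unicyclic_cover G j H) \<longleftrightarrow> Max (?r ` ?\<U>) \<le> int j" for j
  proof -
    have "(\<exists>H. quasi_unicyclic_cover G j H) \<longleftrightarrow>
        (\<forall>U\<in>?\<U>. card {e \<in> edges G. e \<subseteq> U} \<le> j * card U)"
      unfolding cover_iff_sparse[OF assms(1)] using empty_sparse by blast
    also have "\<dots> \<longleftrightarrow> (\<forall>U\<in>?\<U>. ?r U \<le> int j)" using density by blast
    also have "\<dots> \<longleftrightarrow> Max (?r ` ?\<U>) \<le> int j" using fin ne by simp
    finally show ?thesis .
  qed
  \<comment> \<open>Nonnegativity ensures that \<open>nat\<close> does not change the
    maximum.\<close>
  have "0 \<le> ?r U" for U
    using ceiling_mono[of 0 "real (card (edges (induced G U))) / real (card U)"] by simp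
  then have "0 \<le> Max (?r ` ?\<U>)" using Max_in[OF fin ne] by auto
  then have k: "int (nat (Max (?r ` ?\<U>))) = Max (?r ` ?\<U>)" by simp
  then have "min_cover_number G (nat (Max (?r ` ?\<U>)))"
    unfolding min_cover_number_def cover by (simp add: nat_le_iff)
  moreover have "?r ` ?\<U> = {?r U | U. U \<noteq> {} \<and> U \<subseteq> verts G}" by blast
  ultimately show ?thesis using k by (intro exI[of _ "nat (Max (?r ` ?\<U>))"]) simp
qed

section \<open>Time bounds for programs\<close>

fun loop_free :: "prog \<Rightarrow> bool" where
  "loop_free (Store a e f) = True"
| "loop_free (Seq P Q) = (loop_free P \<and> loop_free Q)"
| "loop_free (Cond e P Q) = (loop_free P \<and> loop_free Q)"
| "loop_free (While e P) = False"

text \<open>An evaluator that \<open>simp\<close> can unfold, for loop-free programs. Here and in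
  \<open>time_bound\<close> the equation for \<open>While\<close> is a default that makes the
  function total.\<close>

fun run :: "prog \<Rightarrow> memory \<Rightarrow> memory" where
  "run (Store a e f) M = M(a := (M a)(val M e := val M f))"
| "run (Seq P Q) M = run Q (run P M)"
| "run (Cond e P Q) M = (if val M e \<noteq> 0 then run P M else run Q M)"
| "run (While e P) M = M"

fun time_bound :: "prog \<Rightarrow> nat" where
  "time_bound (Store a e f) = Suc (cost e + cost f)"
| "time_bound (Seq P Q) = time_bound P + time_bound Q"
| "time_bound (Cond e P Q) = Suc (cost e + (time_bound P + time_bound Q))"
| "time_bound (While e P) = 0"

lemma exec_loop_free: "loop_free P \<Longrightarrow> \<exists>t\<le>time_bound P. exec P M t (run P M)"
proof (induction P arbitrary: M)
  case (Store a e f)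
  show ?case using exec.Store[of a e f M] by (auto simp del: fun_upd_apply)
next
  case (Seq P Q)
  obtain s where s: "s \<le> time_bound P" "exec P M s (run P M)"
    using Seq.IH(1) Seq.prems by auto
  obtain t where t: "t \<le> time_bound Q" "exec Q (run P M) t (run Q (run P M))"
    using Seq.IH(2) Seq.prems by auto
  show ?case using exec.Seq[OF s(2) t(2)] s(1) t(1) by (intro exI[of _ "s + t"]) simp
next
  case (Cond e P Q)
  show ?case
  proof (cases "val M e = 0")
    case True
    obtain t where t: "t \<le> time_bound Q" "exec Q M t (run Q M)"
      using Cond.IH(2) Cond.prems by auto
    show ?thesis using exec.Cond_False[where P = P, OF True t(2)] t(1) True
      by (intro exI[of _ "Suc (cost e + t)"]) simp
  next
    case False
    obtain s where s: "s \<le> time_bound P" "exec P M s (run P M)"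
      using Cond.IH(1) Cond.prems by auto
    show ?thesis using exec.Cond_True[where Q = Q, OF False s(2)] s(1) False
      by (intro exI[of _ "Suc (cost e + s)"]) simp
  qed
qed simp

text \<open>Total correctness rule with time: at most \<open>\<mu> M\<close> rounds, each costing
  one test and at most \<open>T\<close> steps, followed by the test that fails.\<close>

lemma exec_While:
  assumes body: "\<And>M. I M \<Longrightarrow> val M e \<noteq> 0 \<Longrightarrow> \<exists>t\<le>T. \<exists>M'. exec P M t M' \<and> I M' \<and> \<mu> M' < \<mu> M"
    and "I M"
  shows "\<exists>t\<le>Suc (cost e) + \<mu> M * (Suc (cost e) + T). \<exists>M'. exec (While e P) M t M' \<and> I M' \<and> val M' e = 0"
  using assms(2)
proof (induction "\<mu> M" arbitrary: M rule: less_induct)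
  case less
  show ?case
  proof (cases "val M e = 0")
    case True
    then show ?thesis using less.prems exec.While_False by (intro exI[of _ "Suc (cost e)"]) auto
  next
    case False
    obtain s M1 where s: "s \<le> T" "exec P M s M1" "I M1" "\<mu> M1 < \<mu> M"
      using body[OF less.prems False] by blast
    obtain t M2 where t: "t \<le> Suc (cost e) + \<mu> M1 * (Suc (cost e) + T)"
      "exec (While e P) M1 t M2" "I M2" "val M2 e = 0"
      using less.hyps[OF s(4,3)] by blast
    have "Suc (\<mu> M1) * (Suc (cost e) + T) \<le> \<mu> M * (Suc (cost e) + T)"
      using s(4) by (intro mult_le_mono1) simp
    then have "Suc (cost e + s + t) \<le> Suc (cost e) + \<mu> M * (Suc (cost e) + T)"
      using s(1) t(1) by simp
    moreover have "exec (While e P) M (Suc (cost e + s + t)) M2"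
      by (rule exec.While_True[OF False s(2) t(2)])
    ultimately show ?thesis using t(3,4) by blast
  qed
qed

section \<open>Labelling the slots of a graph\<close>

text \<open>
  Slot \<open>B + j * n + w\<close> stands for vertex \<open>w\<close> with colour \<open>j\<close>.  Each attempt with a new number of
  colours uses a fresh block of slots starting at a larger \<open>B\<close>, so that no labels have to be reset.
\<close>
definition slots :: "nat \<Rightarrow> nat \<Rightarrow> nat \<Rightarrow> nat set" where
  "slots n B k = {B..<B + k * n}"

text \<open>Index \<open>m\<close>, one past the last edge, has no options. So it can never be
  placed, which identifies the waiting item once the counter has reached \<open>m\<close>.\<close>

definition options :: "nat \<Rightarrow> nat \<Rightarrow> (nat \<Rightarrow> nat) \<Rightarrow> (nat \<Rightarrow> nat) \<Rightarrow> nat \<Rightarrow> nat \<Rightarrow> nat \<Rightarrow> nat set" where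
  "options n m u v B k e = (if e < m then {B + j * n + w | j w. j < k \<and> w \<in> {u e, v e}} else {})"

text \<open>Certificate that \<open>k\<close> parts are too few: some \<open>W\<close> violates the
  density bound, with edges counted by their indices.\<close>

definition overfull :: "nat \<Rightarrow> nat \<Rightarrow> (nat \<Rightarrow> nat) \<Rightarrow> (nat \<Rightarrow> nat) \<Rightarrow> nat \<Rightarrow> bool" where
  "overfull n m u v k \<longleftrightarrow> (\<exists>W\<subseteq>{..<n}. k * card W < card {e. e < m \<and> u e \<in> W \<and> v e \<in> W})"

text \<open>Bounds the number of attempts. A violating \<open>W\<close> is nonempty, because the
  empty set induces no edge.\<close>

lemma overfull_less: "overfull n m u v k \<Longrightarrow> k < m"
proof -
  assume "overfull n m u v k"
  then obtain W where W: "W \<subseteq> {..<n}" "k * card W < card {e. e < m \<and> u e \<in> W \<and> v e \<in> W}"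
    by (auto simp: overfull_def)
  have "W \<noteq> {}" using W(2) by auto
  then have "1 \<le> card W" using W(1) by (auto simp: Suc_le_eq card_gt_0_iff intro: finite_subset)
  then have "k \<le> k * card W" by simp
  also note W(2)
  also have "card {e. e < m \<and> u e \<in> W \<and> v e \<in> W} \<le> card {..<m}" by (rule card_mono) auto
  finally show ?thesis by simp
qed

text \<open>Invariant of the attempt with \<open>k\<close> colours: all items up to \<open>i\<close>
  have been taken up, and \<open>c\<close> is the one waiting for a slot. \<open>P\<close> is the
  colour array. Zero labels beyond the block let the next attempt start there.\<close>

definition state where
  "state n m u v B k i c L H P \<longleftrightarrow> c \<le> i \<and> i \<le> m \<and>
     placement (slots n B k) (options n m u v B k) ({..i} - {c}) L H \<and>
     (\<forall>s\<ge>B + k * n. L s = 0) \<and> (\<forall>s\<in>slots n B k. L s \<le> Suc (k * n)) \<and>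
     (\<forall>s\<in>slots n B k. 0 < L s \<longrightarrow>
        P (H s) < k \<and> (\<exists>w\<in>{u (H s), v (H s)}. s = B + P (H s) * n + w))"

lemma slot_less:
  fixes j k w n B :: nat
  assumes "j < k" "w < n" shows "B + j * n + w < B + k * n"
proof -
  have "j * n + w < Suc j * n" using assms(2) by simp
  also have "\<dots> \<le> k * n" using assms(1) by (intro mult_le_mono1) simp
  finally show ?thesis by simp
qed

context
  fixes n m :: nat and u v :: "nat \<Rightarrow> nat"
  assumes ends: "\<And>e. e < m \<Longrightarrow> u e < n \<and> v e < n"
begin

lemma options_subset: "options n m u v B k e \<subseteq> slots n B k"
proof
  fix s assume "s \<in> options n m u v B k e"
  then obtain j w where s: "e < m" "s = B + j * n + w" "j < k" "w \<in> {u e, v e}"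
    by (auto simp: options_def split: if_splits)
  then have "w < n" using ends[OF s(1)] by auto
  then show "s \<in> slots n B k" using slot_less[OF s(3)] s(2) by (simp add: slots_def)
qed

text \<open>If slot \<open>b\<close> was free, the next index becomes the waiting item, otherwise
  the item displaced from \<open>b\<close> does. The new colour of \<open>c\<close> affects no other
  slot, since \<open>c\<close> was not placed before.\<close>

lemma state_place:
  assumes st: "state n m u v B k i c L H P" and "i < m"
    and b: "b = B + j * n + w" "j < k" "w \<in> {u c, v c}" "L b \<le> k * n"
    and min: "\<And>t. t \<in> options n m u v B k c \<Longrightarrow> L b \<le> L t"
  shows "state n m u v B k (if L b = 0 then Suc i else i) (if L b = 0 then Suc i else H b)
    (L(b := Suc (L b))) (H(b := c)) (P(c := j))"
proof -
  let ?S = "slots n B k" and ?A = "options n m u v B k" and ?O = "{..i} - {c}"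
  have ci: "c \<le> i" and cm: "c < m" using st assms(2) by (auto simp: state_def)
  have P: "placement ?S ?A ?O L H" using st by (simp add: state_def)
  have bA: "b \<in> ?A c" using b cm by (auto simp: options_def)
  then have bS: "b \<in> ?S" using options_subset by blast
  have held: "H s \<in> ?O" if "s \<in> ?S" "0 < L s" for s using P that by (auto simp: placement_def)
  have "placement ?S ?A (insert c ?O - (if L b = 0 then {} else {H b})) (L(b := Suc (L b))) (H(b := c))"
    by (rule placement_swap[OF P _ bS bA min]) simp
  moreover have "insert c ?O - (if L b = 0 then {} else {H b}) =
      {..if L b = 0 then Suc i else i} - {if L b = 0 then Suc i else H b}"
    using ci by auto
  ultimately have "placement ?S ?A ({..if L b = 0 then Suc i else i} - {if L b = 0 then Suc i else H b})
      (L(b := Suc (L b))) (H(b := c))" by simp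
  moreover have "(if L b = 0 then Suc i else H b) \<le> (if L b = 0 then Suc i else i)"
    using held[OF bS] by auto
  moreover have "(if L b = 0 then Suc i else i) \<le> m" using assms(2) by simp
  moreover have "\<forall>s\<ge>B + k * n. (L(b := Suc (L b))) s = 0"
    using st bS by (auto simp: state_def slots_def)
  moreover have "\<forall>s\<in>?S. (L(b := Suc (L b))) s \<le> Suc (k * n)"
    using st b(4) by (auto simp: state_def)
  moreover have "(P(c := j)) ((H(b := c)) s) < k \<and>
      (\<exists>w\<in>{u ((H(b := c)) s), v ((H(b := c)) s)}. s = B + (P(c := j)) ((H(b := c)) s) * n + w)"
    if "s \<in> ?S" "0 < (L(b := Suc (L b))) s" for s
  proof (cases "s = b")
    case True
    then show ?thesis using b by auto
  next
    case False
    then have "0 < L s" "H s \<noteq> c" using that held[of s] by auto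
    then show ?thesis using st that(1) False by (simp add: state_def)
  qed
  ultimately show ?thesis unfolding state_def by simp
qed

text \<open>The ends of the edges in the violating set \<open>J\<close> form \<open>W\<close>. The
  options of \<open>J\<close> are exactly the slots of \<open>W\<close> in all \<open>k\<close>
  colours, so their number is \<open>k * card W\<close>.\<close>

lemma state_stuck:
  assumes st: "state n m u v B k i c L H P" and "i < m"
    and stuck: "\<And>t. t \<in> options n m u v B k c \<Longrightarrow> k * n < L t"
  shows "overfull n m u v k"
proof -
  let ?S = "slots n B k" and ?A = "options n m u v B k"
  have ci: "c \<le> i" and P: "placement ?S ?A ({..i} - {c}) L H" using st by (auto simp: state_def)
  obtain J where J: "J \<subseteq> insert c ({..i} - {c})" "finite J" "card (\<Union>e\<in>J. ?A e) < card J"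
  proof (rule placement_stuck[OF P])
    show "card ?S < L t" if "t \<in> ?A c" for t using stuck[OF that] by (simp add: slots_def)
  qed (use options_subset in \<open>auto simp: slots_def\<close>)
  have Jm: "J \<subseteq> {..<m}" using J(1) ci assms(2) by auto
  define W where "W = u ` J \<union> v ` J"
  have W: "W \<subseteq> {..<n}" using Jm ends by (auto simp: W_def)
  let ?g = "\<lambda>(j, w). B + j * n + w"
  have "inj_on ?g ({..<k} \<times> W)"
  proof (rule inj_onI, clarify)
    fix j w j' w' assume "w \<in> W" "w' \<in> W" and eq: "B + j * n + w = B + j' * n + w'"
    then have lt: "w < n" "w' < n" using W by auto
    \<comment> \<open>As \<open>w < n\<close>, colour and vertex are the quotient and the remainder
      of the slot's offset.\<close>
    have "(j * n + w) div n = (j' * n + w') div n" "(j * n + w) mod n = (j' * n + w') mod n"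
      using eq by simp_all
    then show "j = j' \<and> w = w'" using lt by simp
  qed
  then have "k * card W = card (?g ` ({..<k} \<times> W))"
    by (simp add: card_image card_cartesian_product)
  also have "?g ` ({..<k} \<times> W) = (\<Union>e\<in>J. ?A e)"
  proof
    show "?g ` ({..<k} \<times> W) \<subseteq> (\<Union>e\<in>J. ?A e)"
      using Jm by (fastforce simp: W_def options_def)
    show "(\<Union>e\<in>J. ?A e) \<subseteq> ?g ` ({..<k} \<times> W)"
    proof
      fix s assume "s \<in> (\<Union>e\<in>J. ?A e)"
      then obtain e j w where "e \<in> J" "j < k" "w \<in> {u e, v e}" "s = B + j * n + w"
        by (auto simp: options_def split: if_splits)
      then show "s \<in> ?g ` ({..<k} \<times> W)"
        by (intro image_eqI[of _ _ "(j, w)"]) (auto simp: W_def)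
    qed
  qed
  also note J(3)
  also have "card J \<le> card {e. e < m \<and> u e \<in> W \<and> v e \<in> W}"
    using Jm by (intro card_mono) (auto simp: W_def)
  finally show ?thesis using W by (auto simp: overfull_def)
qed

end

text \<open>With counter and waiting item both 0, the set of placed items is empty. \<open>H\<close>
  and \<open>P\<close> may hold values from an earlier attempt.\<close>

lemma state_restart:
  assumes "\<forall>s\<ge>B. L s = 0"
  shows "state n m u v B k 0 0 L H P"
proof -
  have "{s \<in> slots n B k. 0 < L s} = {}" using assms by (auto simp: slots_def)
  moreover have "L s = 0" if "s \<in> slots n B k" for s using assms that by (simp add: slots_def)
  ultimately show ?thesis using assms by (auto simp: state_def placement_def inj_on_def)
qed

text \<open>Number of label increments left before every label in the block equals
  \<open>Suc (k * n)\<close>; it measures progress within one attempt.\<close>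

definition budget where
  "budget n B k L = (\<Sum>s\<in>slots n B k. Suc (k * n) - L s)"

lemma budget_le: "budget n B k L \<le> k * n * Suc (k * n)"
  using sum_bounded_above[of "slots n B k" "\<lambda>s. Suc (k * n) - L s" "Suc (k * n)"]
  by (simp add: budget_def slots_def)

lemma budget_place: "b \<in> slots n B k \<Longrightarrow> L b \<le> k * n \<Longrightarrow> budget n B k (L(b := Suc (L b))) < budget n B k L"
  unfolding budget_def by (rule sum_strict_mono_ex1) (auto simp: slots_def intro!: bexI[of _ b])

section \<open>The algorithm\<close>

abbreviation reg :: "nat \<Rightarrow> expr" where "reg a \<equiv> At a (Const 0)"
abbreviation set_reg :: "nat \<Rightarrow> expr \<Rightarrow> prog" where "set_reg a \<equiv> Store a (Const 0)"

text \<open>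
  Arrays 5 and 6 hold the labels \<open>L\<close> and the placed edges \<open>H\<close>.  Registers: 7 and 8 first slot in use
  and first slot beyond, 9 counter \<open>i\<close>, 10 current edge \<open>c\<close>, 11 position of the scan, 12 to 14 label,
  slot and colour of the best option so far, 15 colour being scanned, 16 scratch.  The best label starts
  at one more than the number of slots, which is also the threshold for giving up.
\<close>
definition try_end :: "nat \<Rightarrow> prog" where
  "try_end a = Cond (Minus (reg 12) (At 5 (Plus (reg 11) (At a (reg 10)))))
     (Seq (set_reg 12 (At 5 (Plus (reg 11) (At a (reg 10)))))
       (Seq (set_reg 13 (Plus (reg 11) (At a (reg 10)))) (set_reg 14 (reg 15))))
     (set_reg 16 (Const 0))"

definition scan_step :: prog where
  "scan_step = Seq (try_end 1) (Seq (try_end 2)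
     (Seq (set_reg 11 (Plus (reg 11) (At 0 (Const 0)))) (set_reg 15 (Plus (reg 15) (Const 1)))))"

definition scan_init :: prog where
  "scan_init = Seq (set_reg 11 (reg 7)) (Seq (set_reg 12 (Plus (Minus (reg 8) (reg 7)) (Const 1)))
     (set_reg 15 (Const 0)))"

text \<open>Register 12 still holds the old label of the chosen slot, so it is nonzero exactly if
  the slot was occupied. The old occupant is saved in register 16 before it is overwritten.\<close>

definition place :: prog where
  "place = Seq (Store 5 (reg 13) (Plus (reg 12) (Const 1))) (Seq (Store 4 (reg 10) (reg 14))
     (Seq (set_reg 16 (At 6 (reg 13))) (Seq (Store 6 (reg 13) (reg 10))
     (Cond (reg 12) (set_reg 10 (reg 16))
       (Seq (set_reg 9 (Plus (reg 9) (Const 1))) (set_reg 10 (reg 9)))))))"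

text \<open>The new block begins where the old one ends. Register 16 keeps the old block length, to
  which one more layer of \<open>n\<close> slots is added.\<close>

definition new_colour :: prog where
  "new_colour = Seq (set_reg 3 (Plus (reg 3) (Const 1))) (Seq (set_reg 16 (Minus (reg 8) (reg 7)))
     (Seq (set_reg 7 (reg 8)) (Seq (set_reg 8 (Plus (reg 8) (Plus (reg 16) (reg 0))))
     (Seq (set_reg 9 (Const 0)) (set_reg 10 (Const 0))))))"

text \<open>Truncated subtraction acts as a comparison: the test succeeds iff the best label is at
  most the number of slots.\<close>

definition finish :: prog where
  "finish = Cond (Minus (Plus (Minus (reg 8) (reg 7)) (Const 1)) (reg 12)) place new_colour"

definition scan_loop :: prog where
  "scan_loop = While (Minus (reg 8) (reg 11)) scan_step"

definition main_step :: prog where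
  "main_step = Seq scan_init (Seq scan_loop finish)"

definition algorithm :: prog where
  "algorithm = While (Minus (At 0 (Const 1)) (reg 9)) main_step"

section \<open>Correctness of the scan for a best option\<close>

text \<open>\<open>l = Suc K\<close> encodes that no option with label at most \<open>K\<close> was
  found among the first \<open>j\<close> colours; \<open>b\<close> and \<open>q\<close> are then
  unspecified.\<close>

definition scanned :: "nat \<Rightarrow> nat \<Rightarrow> nat \<Rightarrow> (nat \<Rightarrow> nat) \<Rightarrow> nat set \<Rightarrow> nat \<Rightarrow> nat \<Rightarrow> nat \<Rightarrow> nat \<Rightarrow> bool" where
  "scanned n B K L ws j l b q \<longleftrightarrow> l \<le> Suc K \<and>
     (\<forall>j'<j. \<forall>w\<in>ws. l \<le> L (B + j' * n + w)) \<and>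
     (l \<le> K \<longrightarrow> q < j \<and> (\<exists>w\<in>ws. b = B + q * n + w \<and> L b = l))"

text \<open>\<open>M0\<close> is the memory before the scan, which changes only the scratch
  registers 11 to 16.\<close>

definition scan_inv where
  "scan_inv M0 n B k M \<longleftrightarrow> (\<forall>a. a \<notin> {11..16} \<longrightarrow> M a = M0 a) \<and>
     M 15 0 \<le> k \<and> M 11 0 = B + M 15 0 * n \<and>
     scanned n B (k * n) (M0 5) {M0 1 (M0 10 0), M0 2 (M0 10 0)} (M 15 0) (M 12 0) (M 13 0) (M 14 0)"

lemma scan_inv_init:
  assumes "M 8 0 = M 7 0 + k * n"
  shows "scan_inv M n (M 7 0) k (run scan_init M)"
  using assms by (auto simp: scan_inv_def scanned_def scan_init_def)

lemma scan_inv_step: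
  assumes "scan_inv M0 n B k M" "M0 8 0 = B + k * n" "M0 0 0 = n" "val M (Minus (reg 8) (reg 11)) \<noteq> 0"
  shows "scan_inv M0 n B k (run scan_step M)" "run scan_step M 15 0 = Suc (M 15 0)" "M 15 0 < k"
proof -
  let ?c = "M0 10 0" and ?s = "M 11 0" and ?j = "M 15 0" and ?l = "M 12 0" and ?b = "M 13 0" and ?q = "M 14 0"
  let ?p = "?s + M0 1 ?c" and ?p' = "?s + M0 2 ?c"
  have frame: "M a = M0 a" if "a < 11" for a using assms(1) that by (simp add: scan_inv_def)
  have s: "?s = B + ?j * n" using assms(1) by (simp add: scan_inv_def)
  show j: "?j < k"
  proof (rule ccontr)
    assume "\<not> ?j < k"
    then have "k * n \<le> ?j * n" by (intro mult_le_mono1) simp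
    then show False using assms(2,4) s frame by simp
  qed
  \<comment> \<open>The two ends are tried in turn; the second comparison already uses the best
    label updated by the first.\<close>
  define M1 where "M1 = run (try_end 1) M"
  define M2 where "M2 = run (try_end 2) M1"
  have M1: "M1 a = M a" if "a \<notin> {12..16}" for a using that by (auto simp: M1_def try_end_def)
  have M1r: "M1 15 0 = ?j" "M1 12 0 = min ?l (M0 5 ?p)"
    "M1 13 0 = (if M0 5 ?p < ?l then ?p else ?b)" "M1 14 0 = (if M0 5 ?p < ?l then ?j else ?q)"
    by (auto simp: M1_def try_end_def frame)
  have M2: "M2 a = M1 a" if "a \<notin> {12..16}" for a using that by (auto simp: M2_def try_end_def)
  have M2r: "M2 15 0 = M1 15 0" "M2 12 0 = min (M1 12 0) (M0 5 ?p')"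
    "M2 13 0 = (if M0 5 ?p' < M1 12 0 then ?p' else M1 13 0)"
    "M2 14 0 = (if M0 5 ?p' < M1 12 0 then M1 15 0 else M1 14 0)"
    by (auto simp: M2_def try_end_def frame M1)
  have "run scan_step M = run (Seq (set_reg 11 (Plus (reg 11) (At 0 (Const 0)))) (set_reg 15 (Plus (reg 15) (Const 1)))) M2"
    by (simp add: scan_step_def M2_def M1_def)
  also have "\<dots> = (let M3 = M2(11 := (M2 11)(0 := ?s + n)) in M3(15 := (M3 15)(0 := Suc ?j)))"
    by (simp add: M2 M1 frame assms(3) M2r M1r Let_def)
  finally have run: "run scan_step M = (let M3 = M2(11 := (M2 11)(0 := ?s + n)) in M3(15 := (M3 15)(0 := Suc ?j)))" .
  then show "run scan_step M 15 0 = Suc ?j" by (simp add: Let_def)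
  have "scanned n B (k * n) (M0 5) {M0 1 ?c, M0 2 ?c} ?j ?l ?b ?q"
    using assms(1) by (simp add: scan_inv_def)
  then have "scanned n B (k * n) (M0 5) {M0 1 ?c, M0 2 ?c} (Suc ?j) (M2 12 0) (M2 13 0) (M2 14 0)"
    unfolding scanned_def M1r M2r by (auto simp: s less_Suc_eq min_def all_conj_distrib)
  then show "scan_inv M0 n B k (run scan_step M)"
    using j assms(1) s unfolding run by (auto simp: scan_inv_def Let_def M1 M2)
qed

lemma exec_scan:
  assumes "scan_inv M0 n B k M" "M 15 0 = 0" "M0 8 0 = B + k * n" "M0 0 0 = n" "0 < n" "k \<le> m"
  shows "\<exists>t\<le>6 + m * (6 + time_bound scan_step). \<exists>M'. exec scan_loop M t M' \<and> scan_inv M0 n B k M' \<and> M' 15 0 = k"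
proof -
  let ?e = "Minus (reg 8) (reg 11)" and ?T = "time_bound scan_step"
  have cost: "Suc (cost ?e) = 6" by simp
  have "\<exists>t\<le>Suc (cost ?e) + (k - M 15 0) * (Suc (cost ?e) + ?T). \<exists>M'. exec (While ?e scan_step) M t M' \<and>
      scan_inv M0 n B k M' \<and> val M' ?e = 0"
  proof (rule exec_While[where \<mu> = "\<lambda>M. k - M 15 0"])
    fix M assume M: "scan_inv M0 n B k M" "val M ?e \<noteq> 0"
    obtain t where "t \<le> ?T" "exec scan_step M t (run scan_step M)"
      using exec_loop_free[of scan_step M] by (auto simp: scan_step_def try_end_def)
    then show "\<exists>t\<le>?T. \<exists>M'. exec scan_step M t M' \<and> scan_inv M0 n B k M' \<and> k - M' 15 0 < k - M 15 0"
      using scan_inv_step[OF M(1) assms(3,4) M(2)]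
      by (intro exI[of _ t] conjI exI[of _ "run scan_step M"]) auto
  qed (rule assms(1))
  then obtain t M' where t: "t \<le> 6 + k * (6 + ?T)" "exec scan_loop M t M'" "scan_inv M0 n B k M'" "val M' ?e = 0"
    unfolding scan_loop_def assms(2) diff_zero cost by blast
  \<comment> \<open>The scan position is \<open>B\<close> plus the colour times \<open>n\<close>, so
    for \<open>0 < n\<close> the failed test forces the colour counter to be exactly
    \<open>k\<close>.\<close>
  have "M' 15 0 \<le> k" "k * n \<le> M' 15 0 * n" using t(3,4) assms(3) by (auto simp: scan_inv_def)
  then have "M' 15 0 = k" using assms(5) by simp
  moreover have "t \<le> 6 + m * (6 + ?T)"
    using t(1) mult_le_mono1[OF assms(6), of "6 + ?T"] by linarith
  ultimately show ?thesis using t(2,3) by blast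
qed

section \<open>Invariant and running time of the main loop\<close>

text \<open>The last conjunct carries minimality: the preceding number of colours has been
  refuted.\<close>

definition main_inv :: "edge_list \<Rightarrow> memory \<Rightarrow> bool" where
  "main_inv x M \<longleftrightarrow> (\<forall>a<3. M a = input_memory x a) \<and> M 8 0 = M 7 0 + M 3 0 * fst x \<and>
     state (fst x) (length (snd x)) (input_memory x 1) (input_memory x 2)
       (M 7 0) (M 3 0) (M 9 0) (M 10 0) (M 5) (M 6) (M 4) \<and>
     (M 3 0 = 0 \<or> overfull (fst x) (length (snd x)) (input_memory x 1) (input_memory x 2) (M 3 0 - 1))"

definition steps :: "edge_list \<Rightarrow> nat" where
  "steps x = Suc (length (snd x) * fst x * Suc (length (snd x) * fst x))"

text \<open>The lexicographic pair of colours left and budget, packed into one number. The weight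
  \<open>steps x\<close> exceeds the budget of every block with at most
  \<open>length (snd x)\<close> colours.\<close>

definition main_measure :: "edge_list \<Rightarrow> memory \<Rightarrow> nat" where
  "main_measure x M = (length (snd x) - M 3 0) * steps x + budget (fst x) (M 7 0) (M 3 0) (M 5)"


lemma input_memory_ends:
  assumes "x \<in> edge_lists" "e < length (snd x)"
  shows "input_memory x 1 e < fst x \<and> input_memory x 2 e < fst x"
proof -
  obtain a b where "snd x ! e = (a, b)" by (cases "snd x ! e") auto
  then show ?thesis using assms nth_mem[OF assms(2)] by (auto simp: edge_lists_def input_memory_def)
qed

definition step_bound :: "edge_list \<Rightarrow> nat" where
  "step_bound x = time_bound scan_init + (6 + length (snd x) * (6 + time_bound scan_step)) + time_bound finish"

lemma run_finish:
  fixes M :: memory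
  defines "K \<equiv> M 8 0 - M 7 0" and "M' \<equiv> run finish M"
  shows "a < 3 \<Longrightarrow> M' a = M a"
    and "M 12 0 \<le> K \<Longrightarrow> M' 3 = M 3 \<and> M' 7 = M 7 \<and> M' 8 = M 8 \<and>
      M' 9 0 = (if M 12 0 = 0 then Suc (M 9 0) else M 9 0) \<and>
      M' 10 0 = (if M 12 0 = 0 then Suc (M 9 0) else M 6 (M 13 0)) \<and>
      M' 5 = (M 5)(M 13 0 := Suc (M 12 0)) \<and> M' 6 = (M 6)(M 13 0 := M 10 0) \<and>
      M' 4 = (M 4)(M 10 0 := M 14 0)"
    and "\<not> M 12 0 \<le> K \<Longrightarrow> M' 3 0 = Suc (M 3 0) \<and> M' 7 0 = M 8 0 \<and> M' 8 0 = M 8 0 + (K + M 0 0) \<and>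
      M' 9 0 = 0 \<and> M' 10 0 = 0 \<and> M' 5 = M 5"
  by (auto simp: K_def M'_def finish_def place_def new_colour_def)

text \<open>A round either places the waiting edge, which lowers the budget, or refutes
  \<open>k\<close> colours and opens a larger block, which lowers the number of colours
  left.\<close>

lemma main_step_exec:
  assumes x: "x \<in> edge_lists" and inv: "main_inv x M" and cond: "val M (Minus (At 0 (Const 1)) (reg 9)) \<noteq> 0"
  shows "\<exists>t\<le>step_bound x. \<exists>M'. exec main_step M t M' \<and> main_inv x M' \<and> main_measure x M' < main_measure x M"
proof -
  define n m u v where "n = fst x" and "m = length (snd x)" and "u = input_memory x 1" and "v = input_memory x 2"
  define B k i c L H P where "B = M 7 0" and "k = M 3 0" and "i = M 9 0" and "c = M 10 0"
    and "L = M 5" and "H = M 6" and "P = M 4"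
  note defs = n_def m_def u_def v_def B_def k_def i_def c_def L_def H_def P_def
  have inp: "M a = input_memory x a" if "a < 3" for a using inv that by (auto simp: main_inv_def)
  have M0: "M 0 0 = n" "M 0 1 = m" using inp[of 0] by (auto simp: input_memory_def n_def m_def)
  have uv: "M 1 = u" "M 2 = v" using inp[of 1] inp[of 2] by (auto simp: u_def v_def)
  have st: "state n m u v B k i c L H P" and E: "M 8 0 = B + k * n"
    and low: "k = 0 \<or> overfull n m u v (k - 1)"
    using inv by (auto simp: main_inv_def defs)
  have i: "i < m" using cond M0 by (simp add: i_def)
  have ends: "u e < n \<and> v e < n" if "e < m" for e
    using input_memory_ends[OF x, of e] that by (simp add: n_def m_def u_def v_def)
  have cm: "c < m" using st i by (simp add: state_def)
  have npos: "0 < n" using ends[OF cm] by auto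
  have km: "k \<le> m" using low overfull_less[of n m u v "k - 1"] by auto
  let ?M1 = "run scan_init M"
  have s0: "scan_inv M n B k ?M1" using scan_inv_init[of M k n] E by (simp add: B_def)
  have "?M1 15 0 = 0" by (simp add: scan_init_def)
  from exec_scan[OF s0 this E M0(1) npos km] obtain t2 M2 where
    t2: "t2 \<le> 6 + m * (6 + time_bound scan_step)" "exec scan_loop ?M1 t2 M2" and
    M2: "scan_inv M n B k M2" "M2 15 0 = k" by blast
  obtain t1 where t1: "t1 \<le> time_bound scan_init" "exec scan_init M t1 ?M1"
    using exec_loop_free[of scan_init M] by (auto simp: scan_init_def)
  let ?M' = "run finish M2"
  obtain t3 where t3: "t3 \<le> time_bound finish" "exec finish M2 t3 ?M'"
    using exec_loop_free[of finish M2] by (auto simp: finish_def place_def new_colour_def)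
  have "exec main_step M (t1 + (t2 + t3)) ?M'"
    unfolding main_step_def by (rule exec.Seq[OF t1(2) exec.Seq[OF t2(2) t3(2)]])
  moreover have "t1 + (t2 + t3) \<le> step_bound x"
    using t1(1) t2(1) t3(1) by (simp add: step_bound_def m_def)
  moreover have frame: "M2 a = M a" if "a < 11" for a
    using M2(1) that by (simp add: scan_inv_def)
  define l b q where "l = M2 12 0" and "b = M2 13 0" and "q = M2 14 0"
  have scanned: "scanned n B (k * n) L {u c, v c} k l b q"
    using M2(1) unfolding scan_inv_def M2(2) uv l_def b_def q_def L_def c_def by blast
  have min: "l \<le> L t" if "t \<in> options n m u v B k c" for t
    using scanned that by (auto simp: scanned_def options_def split: if_splits)
  have KE: "M2 8 0 - M2 7 0 = k * n" using E by (simp add: frame B_def)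
  have inp': "?M' a = input_memory x a" if "a < 3" for a
    using run_finish(1)[OF that, of M2] frame[of a] inp[OF that] that by simp
  have "main_inv x ?M' \<and> main_measure x ?M' < main_measure x M"
  proof (cases "l \<le> k * n")
    case True
    then obtain w where w: "b = B + q * n + w" "q < k" "w \<in> {u c, v c}" "L b = l"
      using scanned by (auto simp: scanned_def)
    have fin: "?M' 3 0 = k" "?M' 7 0 = B" "?M' 8 0 = B + k * n"
      "?M' 9 0 = (if L b = 0 then Suc i else i)" "?M' 10 0 = (if L b = 0 then Suc i else H b)"
      "?M' 5 = L(b := Suc (L b))" "?M' 6 = H(b := c)" "?M' 4 = P(c := q)"
      using run_finish(2)[of M2] True E w(4)
      unfolding KE by (simp_all add: frame defs l_def b_def q_def)
    have "state n m u v B k (if L b = 0 then Suc i else i) (if L b = 0 then Suc i else H b)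
        (L(b := Suc (L b))) (H(b := c)) (P(c := q))"
      using st i w True min by (intro state_place[OF ends]) auto
    then have inv': "main_inv x ?M'"
      using inp' low unfolding main_inv_def fin n_def m_def u_def v_def by simp
    have "b \<in> options n m u v B k c" unfolding options_def using w cm by auto
    moreover have "options n m u v B k c \<subseteq> slots n B k" by (rule options_subset[OF ends])
    ultimately have "b \<in> slots n B k" by blast
    then have "budget n B k (L(b := Suc (L b))) < budget n B k L"
      using True w(4) by (intro budget_place) auto
    then have "main_measure x ?M' < main_measure x M"
      unfolding main_measure_def fin by (simp add: n_def B_def k_def L_def)
    with inv' show ?thesis ..
  next
    case False
    have fin: "?M' 3 0 = Suc k" "?M' 7 0 = B + k * n" "?M' 8 0 = B + k * n + Suc k * n"
      "?M' 9 0 = 0" "?M' 10 0 = 0" "?M' 5 = L"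
      using run_finish(3)[of M2] False E M0
      unfolding KE by (simp_all add: frame defs l_def)
    \<comment> \<open>The best label stayed above \<open>k * n\<close>, so all options of
      \<open>c\<close> have labels above the number of slots.\<close>
    have over: "overfull n m u v k"
      using False min by (intro state_stuck[OF ends st i]) fastforce+
    then have "Suc k \<le> m" using overfull_less by (simp add: Suc_le_eq)
    have "state n m u v (B + k * n) (Suc k) 0 0 L (?M' 6) (?M' 4)"
      using st by (intro state_restart) (simp add: state_def)
    then have "main_inv x ?M'"
      using inp' over unfolding main_inv_def fin n_def m_def u_def v_def by simp
    moreover have "budget n (B + k * n) (Suc k) L < steps x"
    proof -
      have "Suc k * n \<le> m * n" using \<open>Suc k \<le> m\<close> by (rule mult_le_mono1)
      then have "Suc k * n * Suc (Suc k * n) \<le> m * n * Suc (m * n)"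
        using mult_le_mono Suc_le_mono by blast
      with budget_le[of n "B + k * n" "Suc k" L] have "budget n (B + k * n) (Suc k) L \<le> m * n * Suc (m * n)"
        by (rule order_trans)
      then show ?thesis unfolding steps_def m_def[symmetric] n_def[symmetric] by (rule le_imp_less_Suc)
    qed
    moreover have "(m - k) * steps x = steps x + (m - Suc k) * steps x"
    proof -
      have "m - k = Suc (m - Suc k)" using \<open>Suc k \<le> m\<close> by simp
      then show ?thesis by (simp only: mult_Suc)
    qed
    ultimately show ?thesis
      unfolding main_measure_def fin
      by (simp only: n_def[symmetric] m_def[symmetric] k_def[symmetric]) simp
  qed
  ultimately show ?thesis by blast
qed

text \<open>The cells set to 0 initially describe an attempt with 0 colours and an empty
  block.\<close>

lemma main_inv_input: "main_inv x (input_memory x)"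
proof -
  have "state n m u v 0 0 0 0 (\<lambda>_. 0) H P" for n m u v H P by (rule state_restart) simp
  then show ?thesis by (simp add: main_inv_def input_memory_def)
qed

lemma main_measure_input: "main_measure x (input_memory x) = length (snd x) * steps x"
  by (simp add: main_measure_def input_memory_def budget_def slots_def)

lemma exec_algorithm:
  assumes "x \<in> edge_lists"
  shows "\<exists>t\<le>6 + length (snd x) * steps x * (6 + step_bound x). \<exists>M. exec algorithm (input_memory x) t M \<and>
    main_inv x M \<and> length (snd x) \<le> M 9 0"
proof -
  let ?e = "Minus (At 0 (Const 1)) (reg 9)"
  have cost: "Suc (cost ?e) = 6" by simp
  have "\<exists>t\<le>Suc (cost ?e) + main_measure x (input_memory x) * (Suc (cost ?e) + step_bound x).
      \<exists>M. exec (While ?e main_step) (input_memory x) t M \<and> main_inv x M \<and> val M ?e = 0"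
  proof (rule exec_While[where I = "main_inv x" and \<mu> = "main_measure x"])
    show "\<exists>t\<le>step_bound x. \<exists>M'. exec main_step M t M' \<and> main_inv x M' \<and> main_measure x M' < main_measure x M"
      if "main_inv x M" "val M ?e \<noteq> 0" for M
      by (rule main_step_exec[OF assms that])
  qed (rule main_inv_input)
  moreover have "length (snd x) \<le> M 9 0" if "main_inv x M" "val M ?e = 0" for M
  proof -
    have "M 0 = input_memory x 0" using that(1) by (simp add: main_inv_def)
    then show ?thesis using that(2) by (simp add: input_memory_def)
  qed
  ultimately show ?thesis unfolding cost main_measure_input algorithm_def by blast
qed

section \<open>From the final memory to an optimal decomposition\<close>

lemma simple_graph_of:
  assumes "x \<in> edge_lists"
  shows "simple_graph (graph_of x)"
proof -
  have "\<exists>a<fst x. \<exists>b<fst x. a \<noteq> b \<and> edge_at x e = {a, b}" if e: "e < length (snd x)" for e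
  proof -
    obtain a b where "snd x ! e = (a, b)" by (cases "snd x ! e") auto
    then have "a < fst x" "b < fst x" "a \<noteq> b" "edge_at x e = {a, b}"
      using assms nth_mem[OF e] by (auto simp: edge_lists_def edge_at_def)
    then show ?thesis by blast
  qed
  then show ?thesis unfolding simple_graph_def graph_of_def by fastforce
qed

text \<open>Distinct indices are distinct edges, so \<open>cover_sparse\<close> bounds the number of
  indices inside \<open>W\<close> by \<open>j * card W\<close>.\<close>

lemma overfull_cover:
  assumes x: "x \<in> edge_lists" and "quasi_unicyclic_cover (graph_of x) j C"
    and "overfull (fst x) (length (snd x)) (input_memory x 1) (input_memory x 2) k"
  shows "k < j"
proof -
  let ?u = "input_memory x 1" and ?v = "input_memory x 2"
  obtain W where W: "W \<subseteq> {..<fst x}"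
    "k * card W < card {e. e < length (snd x) \<and> ?u e \<in> W \<and> ?v e \<in> W}"
    using assms(3) by (auto simp: overfull_def)
  let ?I = "{e. e < length (snd x) \<and> ?u e \<in> W \<and> ?v e \<in> W}"
  have "inj_on (edge_at x) ?I" using x by (auto simp: edge_lists_def intro: inj_on_subset)
  then have "card ?I = card (edge_at x ` ?I)" by (simp add: card_image)
  also have "edge_at x ` ?I = {e \<in> edges (graph_of x). e \<subseteq> W}"
    by (auto simp: graph_of_def edge_at_def input_memory_def)
  also have "card \<dots> \<le> j * card W"
    using cover_sparse[OF simple_graph_of[OF x] assms(2)] W(1) by (simp add: graph_of_def)
  finally have "k * card W < j * card W" using W(2) by linarith
  then show ?thesis by simp
qed

lemma main_inv_optimal:
  assumes x: "x \<in> edge_lists" and inv: "main_inv x M" and "length (snd x) \<le> M 9 0"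
  shows "optimal_output x M"
proof -
  define n m u v where "n = fst x" and "m = length (snd x)" and "u = input_memory x 1" and "v = input_memory x 2"
  define B k c L H P where "B = M 7 0" and "k = M 3 0" and "c = M 10 0"
    and "L = M 5" and "H = M 6" and "P = M 4"
  note defs = n_def m_def u_def v_def B_def k_def c_def L_def H_def P_def
  have "M 9 0 = m" using inv assms(3) by (simp add: main_inv_def state_def m_def)
  then have st: "state n m u v B k m c L H P" and low: "k = 0 \<or> overfull n m u v (k - 1)"
    using inv by (auto simp: main_inv_def defs)
  let ?O = "{s \<in> slots n B k. 0 < L s}"
  have im: "H ` ?O = {..m} - {c}" and opt: "\<And>s. s \<in> ?O \<Longrightarrow> s \<in> options n m u v B k (H s)"
    using st by (auto simp: state_def placement_def)
  \<comment> \<open>Index \<open>m\<close> has no options, so it is the waiting item and all edges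
    are placed.\<close>
  have "m \<notin> H ` ?O"
  proof
    assume "m \<in> H ` ?O"
    then obtain s where "s \<in> ?O" "H s = m" by auto
    then show False using opt[of s] by (simp add: options_def)
  qed
  then have im: "H ` ?O = {..<m}" using im by auto
  have coloured: "\<forall>s\<in>slots n B k. 0 < L s \<longrightarrow>
      P (H s) < k \<and> (\<exists>w\<in>{u (H s), v (H s)}. s = B + P (H s) * n + w)"
    using st by (simp add: state_def)
  have "\<exists>s w. H s = e \<and> P e < k \<and> w \<in> {u e, v e} \<and> s = B + P e * n + w" if "e < m" for e
  proof -
    have "e \<in> H ` ?O" using im that by simp
    then obtain s where s: "s \<in> slots n B k" "0 < L s" "H s = e" by auto
    with coloured obtain w where "w \<in> {u e, v e}" "s = B + P e * n + w" "P e < k" by blast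
    with s(3) show ?thesis by blast
  qed
  then obtain s w where sw: "\<And>e. e < m \<Longrightarrow> H (s e) = e \<and> P e < k \<and> w e \<in> {u e, v e} \<and> s e = B + P e * n + w e"
    by metis
  let ?G = "graph_of x"
  have simple: "simple_graph ?G" by (rule simple_graph_of[OF x])
  have inj: "inj_on (edge_at x) {..<m}" using x by (simp add: edge_lists_def m_def)
  \<comment> \<open>The arrays are indexed by positions, whereas \<open>coloured_owner_cover\<close>
    takes functions of edges; \<open>idx\<close> translates.\<close>
  define idx where "idx = the_inv_into {..<m} (edge_at x)"
  have edges: "edges ?G = edge_at x ` {..<m}" by (simp add: graph_of_def m_def)
  have idx: "idx (edge_at x e) = e" if "e < m" for e
    using the_inv_into_f_f[OF inj] that by (simp add: idx_def)
  have "quasi_unicyclic_cover ?G k (\<lambda>j. (verts ?G, {e \<in> edges ?G. P (idx e) = j}))"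
  proof (rule coloured_owner_cover[OF simple])
    show "inj_on (\<lambda>e. (w (idx e), P (idx e))) (edges ?G)"
    proof (rule inj_onI)
      fix e e' assume "e \<in> edges ?G" "e' \<in> edges ?G" and eq: "(w (idx e), P (idx e)) = (w (idx e'), P (idx e'))"
      then obtain a a' where a: "a < m" "e = edge_at x a" "a' < m" "e' = edge_at x a'"
        unfolding edges by auto
      \<comment> \<open>Colour and owner determine the slot, and each slot holds one edge.\<close>
      then have "s a = s a'" using eq sw idx by simp
      then have "a = a'" using sw a by metis
      then show "e = e'" using a by simp
    qed
    fix e assume "e \<in> edges ?G"
    then obtain a where a: "a < m" "e = edge_at x a" unfolding edges by auto
    then show "w (idx e) \<in> e" "P (idx e) < k"
      using sw[OF a(1)] idx[OF a(1)] by (auto simp: edge_at_def u_def v_def input_memory_def m_def)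
  qed
  moreover have "(\<lambda>j. (verts ?G, {e \<in> edges ?G. P (idx e) = j})) = output_part x M"
    unfolding output_part_def edges using idx by (auto simp: fun_eq_iff graph_of_def P_def m_def)
  ultimately have cover: "quasi_unicyclic_cover ?G (output_number M) (output_part x M)"
    by (simp add: output_number_def k_def)
  moreover have "output_number M \<le> j" if "quasi_unicyclic_cover ?G j C" for j C
    using low overfull_cover[OF x that, of "k - 1"] by (auto simp: output_number_def k_def defs)
  ultimately show ?thesis by (auto simp: optimal_output_def min_cover_number_def)
qed

lemma polynomial_time_optimal: "polynomial_time edge_lists input_memory graph_size optimal_output"
proof -
  define C D where "C = 6 + (time_bound scan_init + 6 + time_bound finish)" and "D = 6 + time_bound scan_step"
  let ?X = "[:0, 1:] :: nat poly"
  \<comment> \<open>The time bound \<open>6 + m * steps x * (C + m * D)\<close> with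
    \<open>steps x\<close> expanded and both \<open>m\<close> and \<open>n\<close> replaced by the
    size. \<open>D\<close> is the cost of one scan round, including its test.\<close>
  define p where "p = [:6:] + ?X * ([:1:] + ?X * ?X * ([:1:] + ?X * ?X)) * ([:C:] + ?X * [:D:])"
  have "\<exists>t M. exec algorithm (input_memory x) t M \<and> t \<le> poly p (graph_size x) \<and> optimal_output x M"
    if x: "x \<in> edge_lists" for x
  proof -
    let ?N = "graph_size x" and ?m = "length (snd x)"
    have N: "fst x \<le> ?N" "?m \<le> ?N" by (simp_all add: graph_size_def)
    obtain t M where t: "t \<le> 6 + ?m * steps x * (6 + step_bound x)"
      "exec algorithm (input_memory x) t M" "main_inv x M" "?m \<le> M 9 0"
      using exec_algorithm[OF x] by blast
    note t(1)
    also have "6 + step_bound x = C + ?m * D" by (simp add: step_bound_def C_def D_def)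
    also have "6 + ?m * steps x * (C + ?m * D) \<le> 6 + ?N * (1 + ?N * ?N * (1 + ?N * ?N)) * (C + ?N * D)"
      unfolding steps_def Suc_eq_plus1_left using N by (intro add_mono mult_mono order_refl) auto
    also have "\<dots> = poly p ?N" by (simp add: p_def algebra_simps)
    finally show ?thesis using t(2) main_inv_optimal[OF x t(3,4)] by blast
  qed
  then show ?thesis unfolding polynomial_time_def by blast
qed

theorem theorem4:
  "(\<forall>G :: 'a ugraph. simple_graph G \<and> verts G \<noteq> {} \<longrightarrow>
      (\<exists>k. min_cover_number G k \<and>
           int k = Max {\<lceil>real (card (edges (induced G U))) / real (card U)\<rceil> | U.
                          U \<noteq> {} \<and> U \<subseteq> verts G})) \<and>
   polynomial_time edge_lists input_memory graph_size optimal_output"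
  by (intro conjI allI impI min_cover_number_eq_Max polynomial_time_optimal) simp_all

end
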